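(* Let $\mathbb{F}$ be a field, let $n\geqslant 1$ be an integer, and let $S\subset\mathrm{Mat}_n(\mathbb{F})$ be any set of $n\times n$ matrices. Then $\ell(S)\leqslant 2n\log_2 n+4n-4$.
   Context: $\mathrm{Mat}_n(\mathbb{F})$ is the $\mathbb{F}$-algebra of $n\times n$ matrices over $\mathbb{F}$. For $S\subset\mathrm{Mat}_n(\mathbb{F})$ and an integer $k\geqslant 0$, a word of length $k$ in $S$ is a product $a_1\cdots a_k$ with $a_1,\ldots,a_k\in S$ (the word of length $0$ is the identity matrix $I$). $\mathbb{F}S^{\leqslant k}$ denotes the $\mathbb{F}$-linear span of all words in $S$ of length at most $k$. The length $\ell(S)$ is the smallest integer $k\geqslant 0$ such that $\mathbb{F}S^{\leqslant k}$ equals the full (unital) $\mathbb{F}$-subalgebra of $\mathrm{Mat}_n(\mathbb{F})$ generated by $S$. *)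

theory Defs
  imports Complex_Main "HOL-Algebra.Subrings" "Jordan_Normal_Form.VS_Connect"
begin

definition words_upto :: "nat \<Rightarrow> 'a::field mat set \<Rightarrow> nat \<Rightarrow> 'a mat set" where
  "words_upto n S k =
     {foldr (*) as (1\<^sub>m n) | as. set as \<subseteq> S \<and> length as \<le> k}"

definition span_upto :: "nat \<Rightarrow> 'a::field mat set \<Rightarrow> nat \<Rightarrow> 'a mat set" where
  "span_upto n S k =
     LinearCombinations.module.span class_ring (module_mat TYPE('a) n n) (words_upto n S k)"

(* The last argument of ring_mat only fills the record extension slot. A subring in the
   sense of HOL-Algebra contains the unit of the ambient ring, here the identity matrix. *)
definition unital_subalgebra :: "nat \<Rightarrow> 'a::field mat set \<Rightarrow> bool" where
  "unital_subalgebra n B \<longleftrightarrow>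
     subring B (ring_mat TYPE('a) n ()) \<and> (\<forall>c. \<forall>A\<in>B. c \<cdot>\<^sub>m A \<in> B)"

definition generated_algebra :: "nat \<Rightarrow> 'a::field mat set \<Rightarrow> 'a mat set" where
  "generated_algebra n S = \<Inter>{B. unital_subalgebra n B \<and> S \<subseteq> B}"

(* For S \<subseteq> carrier_mat n n such a k exists: the spans form an increasing chain in a
   finite-dimensional space, and their union is the generated algebra. *)
definition alg_length :: "nat \<Rightarrow> 'a::field mat set \<Rightarrow> nat" where
  "alg_length n S = (LEAST k. span_upto n S k = generated_algebra n S)"

end

theory Submission
  imports Defs "HOL-Library.Function_Algebras" "HOL-Algebra.Algebraic_Closure_Type"
begin

text \<open>
  Lengths are subadditive up to \<open>1\<close> along invariant subspaces: if \<open>w1 - c1\<close> kills \<open>W\<close> and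
  \<open>w2 - c2\<close> maps \<open>V\<close> into \<open>W\<close>, then \<open>(w1 - c1) (w2 - c2) = 0\<close> on \<open>V\<close>. Since
  \<open>2 n log n + 2 n - 2\<close> absorbs the loss, it suffices to bound irreducible actions, and one may pass to
  the algebraic closure, from which linear relations descend along a linear retraction.

  For an irreducible action on \<open>C\<close> with \<open>dim C = n\<close>, a matrix \<open>A\<close> of rank one in the span of words
  of length \<open>k\<close> yields all operators in length \<open>k + 2 (n - 1)\<close>. Such an \<open>A\<close> is found by lowering
  the rank \<open>r\<close> while maintaining \<open>k r \<le> 2 n log (n / r)\<close>. Take a shortest word \<open>w\<close>, of length \<open>L\<close>,
  for which \<open>B = A w\<close> is not scalar on the image \<open>U\<close> of \<open>A\<close>, and let \<open>d\<close> be the degree of the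
  minimal polynomial of \<open>B\<close> on \<open>U\<close>. Dropping one linear factor of it leaves a polynomial \<open>q\<close> such
  that \<open>q(B)\<close> has rank \<open>\<rho> > 0\<close> on \<open>U\<close> with \<open>d \<rho> \<le> r\<close> and \<open>(d - 1) \<rho> \<le> rank (B - c)\<close> for all
  scalars \<open>c\<close>. The minimality of \<open>w\<close> gives \<open>L (d - 1) \<rho> \<le> 2 n\<close>. Hence \<open>q(B) A\<close> has rank
  \<open>\<rho> \<le> r / 2\<close> and length \<open>k' = d k + (d - 1) L\<close>, so that \<open>k' \<rho> \<le> k r + 2 n\<close>.
\<close>

section \<open>Finite-dimensional subspaces\<close>

locale operator_space = vector_space scale
  for scale :: "'a::field \<Rightarrow> 'b::ab_group_add \<Rightarrow> 'b" (infixr "*s" 75)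
begin

interpretation vs_pair: vector_space_pair scale scale ..

abbreviation endo :: "('b \<Rightarrow> 'b) \<Rightarrow> bool" where
  "endo f \<equiv> Vector_Spaces.linear scale scale f"

lemma endo_iff:
  "endo f \<longleftrightarrow> (\<forall>x y. f (x + y) = f x + f y) \<and> (\<forall>c x. f (c *s x) = c *s f x)"
  using vector_space_axioms by (auto simp: Vector_Spaces.linear_iff)

lemma endo_add: "endo f \<Longrightarrow> f (x + y) = f x + f y"
  and endo_scale: "endo f \<Longrightarrow> f (c *s x) = c *s f x"
  by (simp_all add: endo_iff)

lemma endo_zero: "endo f \<Longrightarrow> f 0 = 0"
  using endo_scale[of f 0 0] by simp

lemma endo_diff: "endo f \<Longrightarrow> f (x - y) = f x - f y"
  by (metis add_diff_cancel diff_add_cancel endo_add)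

lemma endo_sum: "endo f \<Longrightarrow> f (\<Sum>i\<in>I. g i) = (\<Sum>i\<in>I. f (g i))"
  by (induction I rule: infinite_finite_induct) (auto simp: endo_zero endo_add)

lemma endo_comp: "endo f \<Longrightarrow> endo g \<Longrightarrow> endo (f \<circ> g)"
  by (simp add: endo_iff)

lemma endo_sub_scale: "endo f \<Longrightarrow> endo (\<lambda>x. f x - c *s x)"
  by (simp add: endo_iff algebra_simps scale_left_commute)

lemma subspace_kernel_on: "endo f \<Longrightarrow> subspace Q \<Longrightarrow> subspace {x\<in>Q. f x = 0}"
  by (auto simp: subspace_def endo_add endo_scale endo_zero)

lemma subspace_preimage_on: "endo f \<Longrightarrow> subspace Q \<Longrightarrow> subspace Z \<Longrightarrow> subspace {x\<in>Q. f x \<in> Z}"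
  by (auto simp: subspace_def endo_add endo_scale endo_zero)

lemma subspace_endo_image: "endo f \<Longrightarrow> subspace Q \<Longrightarrow> subspace (f ` Q)"
  by (rule vs_pair.linear_subspace_image)

text \<open>The ambient space of the application, functions on \<open>nat\<close>, is
  infinite-dimensional, so finiteness is a property of subspaces. Without it \<open>dim\<close> says
  little: an infinite basis has cardinality 0.\<close>

definition fin_subspace :: "'b set \<Rightarrow> bool" where
  "fin_subspace Q \<longleftrightarrow> subspace Q \<and> (\<exists>B. finite B \<and> Q \<subseteq> span B)"

lemma fin_subspaceD: "fin_subspace Q \<Longrightarrow> subspace Q"
  by (simp add: fin_subspace_def)

lemma fin_subspace_basis_extend:
  assumes "fin_subspace Q" "independent B0" "B0 \<subseteq> Q"
  obtains B where "B0 \<subseteq> B" "B \<subseteq> Q" "independent B" "finite B" "span B = Q" "card B = dim Q"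
proof -
  obtain B where B: "B0 \<subseteq> B" "B \<subseteq> Q" "independent B" "Q \<subseteq> span B"
    using maximal_independent_subset_extend[OF assms(3,2)] by blast
  obtain T where "finite T" "Q \<subseteq> span T"
    using assms(1) by (auto simp: fin_subspace_def)
  then have "finite B"
    using independent_span_bound[of T B] B by blast
  moreover have "span B = Q"
    using B assms(1) by (intro span_subspace) (auto simp: fin_subspace_def)
  moreover have "card B = dim Q"
    using B by (intro basis_card_eq_dim) auto
  ultimately show thesis using that B by blast
qed

lemma fin_subspace_basis:
  assumes "fin_subspace Q"
  obtains B where "B \<subseteq> Q" "independent B" "finite B" "span B = Q" "card B = dim Q"
  using fin_subspace_basis_extend[OF assms independent_empty] by blast

lemma independent_card_le:
  assumes "fin_subspace Q" "independent A" "A \<subseteq> Q"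
  shows "finite A \<and> card A \<le> dim Q"
proof -
  obtain B where "B \<subseteq> Q" "independent B" "finite B" "span B = Q" "card B = dim Q"
    by (rule fin_subspace_basis[OF assms(1)])
  then show ?thesis using independent_span_bound[of B A] assms by auto
qed

lemma fin_subspace_subset: "fin_subspace Y \<Longrightarrow> subspace Q \<Longrightarrow> Q \<subseteq> Y \<Longrightarrow> fin_subspace Q"
  by (meson fin_subspace_def order_trans)

lemma fin_subspace_dim_mono:
  assumes "fin_subspace Y" "subspace Q" "Q \<subseteq> Y"
  shows "dim Q \<le> dim Y"
proof -
  obtain B where "B \<subseteq> Q" "independent B" "finite B" "span B = Q" "card B = dim Q"
    by (rule fin_subspace_basis[OF fin_subspace_subset[OF assms]])
  then show ?thesis using independent_card_le[OF assms(1), of B] assms(3) by auto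
qed

lemma fin_subspace_dim_eq:
  assumes "fin_subspace Y" "subspace Q" "Q \<subseteq> Y" "dim Y \<le> dim Q"
  shows "Q = Y"
proof -
  obtain B where B: "B \<subseteq> Q" "independent B" "finite B" "span B = Q" "card B = dim Q"
    by (rule fin_subspace_basis[OF fin_subspace_subset[OF assms(1-3)]])
  have BY: "B \<subseteq> Y" using B(1) assms(3) by blast
  obtain B' where B': "B \<subseteq> B'" "B' \<subseteq> Y" "independent B'" "finite B'" "span B' = Y" "card B' = dim Y"
    by (rule fin_subspace_basis_extend[OF assms(1) B(2) BY])
  have "B = B'" using card_seteq[OF B'(4,1)] B(5) B'(6) assms(4) by simp
  then show ?thesis using B B' by blast
qed

lemma fin_subspace_dim_less:
  assumes "fin_subspace Y" "subspace Q" "Q \<subset> Y"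
  shows "dim Q < dim Y"
  using fin_subspace_dim_eq[OF assms(1,2)] assms(3) by force

lemma fin_subspace_dim_0:
  assumes "fin_subspace Q" "dim Q = 0"
  shows "Q = {0}"
  using fin_subspace_basis[OF assms(1)] assms(2) by (metis card_0_eq span_empty)

lemma dim_zero_space [simp]: "dim {0} = 0"
  using dim_le_card[of "{0}" "{}"] by simp

lemma fin_subspace_dim_pos:
  assumes "fin_subspace Q" "x \<in> Q" "x \<noteq> 0"
  shows "0 < dim Q"
  using fin_subspace_dim_0[OF assms(1)] assms by fastforce

lemma fin_subspace_image:
  assumes "fin_subspace Q" "endo g"
  shows "fin_subspace (g ` Q)"
proof -
  obtain B where "finite B" "Q \<subseteq> span B" using assms(1) by (auto simp: fin_subspace_def)
  then have "g ` Q \<subseteq> span (g ` B)" using vs_pair.linear_spans_image[OF assms(2)] by blast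
  then show ?thesis
    using assms \<open>finite B\<close> by (auto simp: fin_subspace_def subspace_endo_image)
qed

text \<open>With \<open>U'\<close> the preimage of \<open>Z\<close> in \<open>U\<close>,
  \<open>g\<close> induces an injection of U/U' into Y/Z. The case \<open>Z = {0}\<close> gives
  rank-nullity; the general case later measures the growth of chains of subspaces.\<close>

lemma dim_extend:
  assumes U: "fin_subspace U" and Y: "fin_subspace Y" and Z: "subspace Z" "Z \<subseteq> Y"
    and g: "endo g" "g ` U \<subseteq> Y"
  shows "dim Z + dim U \<le> dim Y + dim {u\<in>U. g u \<in> Z}"
proof -
  let ?U' = "{u\<in>U. g u \<in> Z}"
  have sU: "subspace U" using U fin_subspaceD by blast
  have fU': "fin_subspace ?U'"
    using fin_subspace_subset[OF U] subspace_preimage_on[OF g(1) sU Z(1)] by blast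
  obtain B0 where B0: "B0 \<subseteq> ?U'" "independent B0" "finite B0" "span B0 = ?U'" "card B0 = dim ?U'"
    by (rule fin_subspace_basis[OF fU'])
  have B0U: "B0 \<subseteq> U" using B0(1) by blast
  obtain B where B: "B0 \<subseteq> B" "B \<subseteq> U" "independent B" "finite B" "span B = U" "card B = dim U"
    by (rule fin_subspace_basis_extend[OF U B0(2) B0U])
  obtain D where D: "D \<subseteq> Z" "independent D" "finite D" "span D = Z" "card D = dim Z"
    by (rule fin_subspace_basis[OF fin_subspace_subset[OF Y Z]])
  \<comment> \<open>Basis vectors of \<open>U\<close> outside the preimage have images independent
    modulo \<open>Z\<close>. The cardinality equation also records that \<open>g\<close> is
    injective on them and that the images avoid \<open>D\<close>.\<close>
  have main: "finite E \<Longrightarrow> E \<subseteq> B - B0 \<Longrightarrow>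
      independent (D \<union> g ` E) \<and> card (D \<union> g ` E) = card D + card E" for E
  proof (induction E rule: finite_induct)
    case empty
    then show ?case using D by simp
  next
    case (insert e E)
    have EB: "E \<subseteq> B - {e}" "B0 \<subseteq> B - {e}" "e \<in> B"
      using insert B(1) by auto
    \<comment> \<open>Otherwise \<open>g e = z + g x\<close> with \<open>z\<close> in
      \<open>Z\<close>, so \<open>e - x\<close> lies in the preimage and \<open>e\<close> in the
      span of the other basis vectors.\<close>
    have new: "g e \<notin> span (D \<union> g ` E)"
    proof
      assume "g e \<in> span (D \<union> g ` E)"
      then obtain z y where zy: "g e = z + y" "z \<in> span D" "y \<in> span (g ` E)"
        unfolding span_Un by blast
      then obtain x where x: "x \<in> span E" "y = g x"
        using vs_pair.linear_span_image[OF g(1)] by blast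
      have x': "x \<in> span (B - {e})" using x(1) span_mono[OF EB(1)] by blast
      then have "x \<in> U" using B(5) span_mono[of "B - {e}" B] by blast
      then have "e - x \<in> U" using EB(3) B(2) sU subspace_diff by blast
      moreover have "g (e - x) = z" using zy x endo_diff[OF g(1)] by simp
      ultimately have "e - x \<in> span B0" using zy D(4) B0(4) by auto
      then have "e - x \<in> span (B - {e})" using span_mono[OF EB(2)] by blast
      then have "e \<in> span (B - {e})" using span_add[OF _ x'] by fastforce
      then show False using B(3) EB(3) dependent_def by auto
    qed
    then have "g e \<notin> D \<union> g ` E" using span_superset by (meson subsetD)
    moreover have IH: "independent (D \<union> g ` E)" "card (D \<union> g ` E) = card D + card E"
      using insert.IH insert.prems by auto
    moreover have "D \<union> g ` insert e E = insert (g e) (D \<union> g ` E)" by auto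
    ultimately show ?case
      using insert.hyps D(3) independent_insertI[OF new IH(1)] by simp
  qed
  have fE: "finite (B - B0)" using B by simp
  have "D \<union> g ` (B - B0) \<subseteq> Y" using D(1) Z(2) g(2) B(2) by blast
  then have "card D + card (B - B0) \<le> dim Y"
    using independent_card_le[OF Y, of "D \<union> g ` (B - B0)"] main[OF fE subset_refl] by simp
  moreover have "card B = card (B - B0) + card B0"
    using B(1,4) B0(3) by (simp add: card_Diff_subset card_mono)
  ultimately show ?thesis using B(6) B0(5) D(5) by simp
qed

lemma rank_nullity:
  assumes U: "fin_subspace U" and g: "endo g"
  shows "dim (g ` U) + dim {u\<in>U. g u = 0} = dim U"
proof (rule antisym)
  let ?K = "{u\<in>U. g u = 0}"
  have fK: "fin_subspace ?K"
    using fin_subspace_subset[OF U] subspace_kernel_on[OF g] fin_subspaceD[OF U] by blast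
  obtain B0 where B0: "B0 \<subseteq> ?K" "independent B0" "finite B0" "span B0 = ?K" "card B0 = dim ?K"
    by (rule fin_subspace_basis[OF fK])
  have B0U: "B0 \<subseteq> U" using B0(1) by blast
  obtain B where B: "B0 \<subseteq> B" "B \<subseteq> U" "independent B" "finite B" "span B = U" "card B = dim U"
    by (rule fin_subspace_basis_extend[OF U B0(2) B0U])
  have "g ` B \<subseteq> insert 0 (g ` (B - B0))" using B0(1) by auto
  then have "g ` U \<subseteq> span (g ` (B - B0))"
    using vs_pair.linear_span_image[OF g, of B] B(5) span_mono span_insert_0 by metis
  then have "dim (g ` U) \<le> card (g ` (B - B0))" using dim_le_card B(4) by simp
  also have "\<dots> \<le> card (B - B0)" using B(4) card_image_le by blast
  also have "\<dots> = card B - card B0" using B0(3) B(1) by (rule card_Diff_subset)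
  finally show "dim (g ` U) + dim ?K \<le> dim U"
    using card_mono[OF B(4,1)] B(6) B0(5) by simp
next
  show "dim U \<le> dim (g ` U) + dim {u\<in>U. g u = 0}"
    using dim_extend[OF U fin_subspace_image[OF U g], of "{0}" g] g
      fin_subspaceD[OF fin_subspace_image[OF U g]] by (auto simp: subspace_0)
qed

lemma dim_image_le_on: "fin_subspace U \<Longrightarrow> endo g \<Longrightarrow> dim (g ` U) \<le> dim U"
  using rank_nullity by fastforce

section \<open>Spans of words\<close>

definition opword :: "('b \<Rightarrow> 'b) list \<Rightarrow> 'b \<Rightarrow> 'b" where
  "opword ws = foldr (\<circ>) ws id"

lemma opword_Nil [simp]: "opword [] = id"
  and opword_Cons [simp]: "opword (s # ws) = s \<circ> opword ws"
  by (simp_all add: opword_def)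

lemma opword_append: "opword (vs @ ws) = opword vs \<circ> opword ws"
  by (induction vs) (auto simp: comp_assoc)

lemma endo_opword: "(\<And>s. s \<in> set ws \<Longrightarrow> endo s) \<Longrightarrow> endo (opword ws)"
  by (induction ws) (auto simp: endo_iff)

text \<open>Generating the span inductively avoids a vector space structure on operators; the zero
  operator arises by scaling with 0.\<close>

inductive_set wspan :: "('b \<Rightarrow> 'b) set \<Rightarrow> nat \<Rightarrow> ('b \<Rightarrow> 'b) set" for S k where
  word: "set ws \<subseteq> S \<Longrightarrow> length ws \<le> k \<Longrightarrow> opword ws \<in> wspan S k"
| add: "f \<in> wspan S k \<Longrightarrow> g \<in> wspan S k \<Longrightarrow> (\<lambda>x. f x + g x) \<in> wspan S k"
| scale: "f \<in> wspan S k \<Longrightarrow> (\<lambda>x. c *s f x) \<in> wspan S k"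

lemma wspan_mono: "f \<in> wspan S k \<Longrightarrow> k \<le> l \<Longrightarrow> f \<in> wspan S l"
  by (induction rule: wspan.induct) (auto intro: wspan.intros)

lemma wspan_id: "id \<in> wspan S k"
  using wspan.word[of "[]" S k] by simp

lemma wspan_zero: "(\<lambda>x. 0) \<in> wspan S k"
  using wspan.scale[OF wspan_id, of 0 S k] by simp

lemma wspan_diff:
  assumes "f \<in> wspan S k" "g \<in> wspan S k"
  shows "(\<lambda>x. f x - g x) \<in> wspan S k"
  using wspan.add[OF assms(1) wspan.scale[OF assms(2), of "-1"]] by simp

lemma wspan_endo: "f \<in> wspan S k \<Longrightarrow> (\<And>s. s \<in> S \<Longrightarrow> endo s) \<Longrightarrow> endo f"
proof (induction rule: wspan.induct)
  case (word ws)
  then show ?case by (intro endo_opword) auto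
qed (auto simp: endo_iff algebra_simps scale_left_commute)

lemma opword_invariant:
  "set ws \<subseteq> S \<Longrightarrow> \<forall>s\<in>S. \<forall>x\<in>Q. s x \<in> Q \<Longrightarrow> x \<in> Q \<Longrightarrow> opword ws x \<in> Q"
  by (induction ws) auto

lemma wspan_invariant:
  assumes "f \<in> wspan S k" "subspace Q" "\<forall>s\<in>S. \<forall>x\<in>Q. s x \<in> Q" "x \<in> Q"
  shows "f x \<in> Q"
  using assms(1)
proof (induction rule: wspan.induct)
  case (word ws)
  then show ?case using opword_invariant assms by blast
qed (auto intro: subspace_add subspace_scale assms(2))

lemma wspan_comp:
  assumes S: "\<And>s. s \<in> S \<Longrightarrow> endo s" and f: "f \<in> wspan S k" and g: "g \<in> wspan S l"
  shows "f \<circ> g \<in> wspan S (k + l)"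
  using f
proof (induction rule: wspan.induct)
  case w: (word ws)
  have e: "endo (opword ws)" using w S by (intro endo_opword) auto
  show ?case using g
  proof (induction rule: wspan.induct)
    case (word vs)
    then show ?case using wspan.word[of "ws @ vs" S "k + l"] w by (simp add: opword_append o_def)
  next
    case (add f g)
    then show ?case using wspan.add by (fastforce simp: o_def endo_add[OF e])
  next
    case (scale f c)
    then show ?case using wspan.scale by (fastforce simp: o_def endo_scale[OF e])
  qed
next
  case (add f1 f2)
  then show ?case using wspan.add by (fastforce simp: o_def)
next
  case (scale f c)
  then show ?case using wspan.scale by (fastforce simp: o_def)
qed

lemma wspan_letter: "s \<in> S \<Longrightarrow> s \<in> wspan S 1"
  using wspan.word[of "[s]" S 1] by simp

end

section \<open>Irreducible actions\<close>

locale irreducible_ops = operator_space scale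
  for scale :: "'a::field \<Rightarrow> 'b::ab_group_add \<Rightarrow> 'b" (infixr "*s" 75) +
  fixes S :: "('b \<Rightarrow> 'b) set" and C :: "'b set"
  assumes endo_letter: "s \<in> S \<Longrightarrow> endo s"
    and fin_C: "fin_subspace C"
    and nontrivial: "C \<noteq> {0}"
    and letter_closed: "s \<in> S \<Longrightarrow> x \<in> C \<Longrightarrow> s x \<in> C"
    and irreducible: "subspace Q \<Longrightarrow> Q \<subseteq> C \<Longrightarrow> (\<And>s x. s \<in> S \<Longrightarrow> x \<in> Q \<Longrightarrow> s x \<in> Q) \<Longrightarrow> Q = {0} \<or> Q = C"
begin

lemma sub_C: "subspace C"
  using fin_C fin_subspaceD by blast

lemma wspan_closed: "f \<in> wspan S k \<Longrightarrow> x \<in> C \<Longrightarrow> f x \<in> C"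
  using wspan_invariant[OF _ sub_C] letter_closed by blast

lemma wspan_is_endo: "f \<in> wspan S k \<Longrightarrow> endo f"
  using wspan_endo endo_letter by blast

lemma wspan_cons: "s \<in> S \<Longrightarrow> f \<in> wspan S k \<Longrightarrow> s \<circ> f \<in> wspan S (Suc k)"
  using wspan_comp[where f = s and g = f and k = 1 and l = k, OF endo_letter wspan_letter] by simp

lemma wspan_snoc: "s \<in> S \<Longrightarrow> f \<in> wspan S k \<Longrightarrow> f \<circ> s \<in> wspan S (Suc k)"
  using wspan_comp[where f = f and g = s and k = k and l = 1, OF endo_letter _ wspan_letter] by simp

lemma dim_C_pos: "0 < dim C"
  using fin_subspace_dim_0[OF fin_C] nontrivial by auto

text \<open>Once the reachable spaces \<open>Q k\<close> stop growing they are invariant, hence all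
  of \<open>C\<close>. Since \<open>Q 0\<close> already contains \<open>u\<close>, strict growth
  fills \<open>C\<close> after \<open>dim C - 1\<close> letters.\<close>

lemma orbit_full:
  assumes u: "u \<in> C" "u \<noteq> 0" and x: "x \<in> C"
  obtains f where "f \<in> wspan S (dim C - 1)" "f u = x"
proof -
  define Q where "Q k = (\<lambda>f. f u) ` wspan S k" for k
  have sQ: "subspace (Q k)" for k
  proof (rule subspaceI)
    show "0 \<in> Q k" using wspan_zero by (force simp: Q_def)
    show "x + y \<in> Q k" if "x \<in> Q k" "y \<in> Q k" for x y
      using that wspan.add unfolding Q_def by (auto intro!: image_eqI)
    show "c *s x \<in> Q k" if "x \<in> Q k" for c x
      using that wspan.scale unfolding Q_def by (auto intro!: image_eqI)
  qed
  have QC: "Q k \<subseteq> C" for k using wspan_closed u by (auto simp: Q_def)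
  have Q_Suc: "Q k \<subseteq> Q (Suc k)" for k
    using wspan_mono[of _ S k "Suc k"] by (auto simp: Q_def)
  have Q_letter: "s x \<in> Q (Suc k)" if "s \<in> S" "x \<in> Q k" for s x k
    using that wspan_cons[of s _ k] unfolding Q_def by (force simp: o_def)
  have u0: "u \<in> Q 0" unfolding Q_def by (rule image_eqI[of _ _ id]) (auto simp: wspan_id)
  have uQ: "u \<in> Q k" for k by (induction k) (use u0 Q_Suc in auto)
  have "Q k = C \<or> k < dim (Q k)" for k
  proof (induction k)
    case 0
    show ?case using fin_subspace_dim_pos[OF fin_subspace_subset[OF fin_C sQ QC] u0 u(2)] by simp
  next
    case (Suc k)
    show ?case
    proof (cases "Q (Suc k) = Q k")
      case True
      then have "Q k = {0} \<or> Q k = C" using irreducible[OF sQ QC] Q_letter by metis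
      then show ?thesis using uQ[of k] u(2) True by auto
    next
      case False
      then have "dim (Q k) < dim (Q (Suc k))"
        using fin_subspace_dim_less[OF fin_subspace_subset[OF fin_C sQ QC] sQ] Q_Suc by blast
      moreover have "Q (Suc k) = C" if "Q k = C" using that Q_Suc[of k] QC[of "Suc k"] by simp
      ultimately show ?thesis using Suc.IH by linarith
    qed
  qed
  then have "Q (dim C - 1) = C \<or> dim C \<le> dim (Q (dim C - 1))"
    by (metis Suc_leI Suc_pred' dim_C_pos)
  then have "Q (dim C - 1) = C"
    using fin_subspace_dim_eq[OF fin_C sQ QC] by blast
  then have "x \<in> (\<lambda>f. f u) ` wspan S (dim C - 1)" using x unfolding Q_def by blast
  then show thesis using that by blast
qed

text \<open>Dual to \<open>orbit_full\<close>: the common kernels \<open>N k\<close> shrink strictly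
  until they are invariant, hence zero, as \<open>x0\<close> never lies in them. \<open>N 0\<close>
  misses \<open>x0\<close>, which saves one of the \<open>dim C\<close> steps.\<close>

lemma coorbit_full:
  assumes A: "endo A" "x0 \<in> C" "A x0 \<noteq> 0" and x: "x \<in> C" "x \<noteq> 0"
  obtains f where "f \<in> wspan S (dim C - 1)" "A (f x) \<noteq> 0"
proof -
  define N where "N k = {x\<in>C. \<forall>f\<in>wspan S k. A (f x) = 0}" for k
  have sN: "subspace (N k)" for k
  proof (rule subspaceI)
    show "0 \<in> N k"
      by (auto simp: N_def A endo_zero wspan_is_endo subspace_0 sub_C)
    show "x + y \<in> N k" if "x \<in> N k" "y \<in> N k" for x y
      using that by (auto simp: N_def A(1) endo_add wspan_is_endo subspace_add sub_C)
    show "c *s x \<in> N k" if "x \<in> N k" for c x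
      using that by (auto simp: N_def A(1) endo_scale wspan_is_endo subspace_scale sub_C)
  qed
  have NC: "N k \<subseteq> C" for k by (auto simp: N_def)
  have N_Suc: "N (Suc k) \<subseteq> N k" for k
    using wspan_mono[of _ S k "Suc k"] by (auto simp: N_def)
  have N_letter: "s x \<in> N k" if "s \<in> S" "x \<in> N (Suc k)" for s x k
    using that wspan_snoc[of s _ k] letter_closed unfolding N_def by (force simp: o_def)
  have x0: "x0 \<notin> N k" for k using A(3) wspan_id[of S k] by (force simp: N_def)
  have "N k = {0} \<or> dim (N k) + k < dim C" for k
  proof (induction k)
    case 0
    have "N 0 \<subset> C" using x0[of 0] A(2) NC[of 0] by blast
    then show ?case using fin_subspace_dim_less[OF fin_C sN] by simp
  next
    case (Suc k)
    show ?case
    proof (cases "N (Suc k) = N k")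
      case True
      then have "N (Suc k) = {0} \<or> N (Suc k) = C" using irreducible[OF sN NC] N_letter by metis
      then show ?thesis using x0[of "Suc k"] A(2) by auto
    next
      case False
      then have "dim (N (Suc k)) < dim (N k)"
        using fin_subspace_dim_less[OF fin_subspace_subset[OF fin_C sN NC] sN] N_Suc by blast
      moreover have "N (Suc k) = {0}" if "N k = {0}"
        using that N_Suc[of k] subspace_0[OF sN, of "Suc k"] by auto
      ultimately show ?thesis using Suc.IH by linarith
    qed
  qed
  from this[of "dim C - 1"] have "N (dim C - 1) = {0}"
    using fin_subspace_dim_0[OF fin_subspace_subset[OF fin_C sN NC]] dim_C_pos by force
  then show thesis using x that by (auto simp: N_def)
qed

text \<open>Operators \<open>a \<circ> A \<circ> b\<close> with \<open>a\<close>, \<open>b\<close>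
  of length at most \<open>dim C - 1\<close> have rank at most one on \<open>C\<close>. A suitable
  \<open>b\<close> keeps a given nonzero vector from being killed, and \<open>a\<close> sends its
  image anywhere, so sums of such operators interpolate \<open>T\<close>.\<close>

lemma rank_one_spans:
  assumes A: "A \<in> wspan S k" "dim (A ` C) = 1"
    and T: "endo T" "\<And>x. x \<in> C \<Longrightarrow> T x \<in> C"
  obtains f where "f \<in> wspan S (k + 2 * (dim C - 1))" "\<And>x. x \<in> C \<Longrightarrow> f x = T x"
proof -
  let ?m = "dim C - 1"
  have eA: "endo A" using A(1) by (rule wspan_is_endo)
  have "A ` C \<noteq> {0}" using A(2) by auto
  then obtain x0 where x0: "x0 \<in> C" "A x0 \<noteq> 0"
    using endo_zero[OF eA] subspace_0[OF sub_C] by force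
  have "\<exists>f\<in>wspan S (k + 2 * ?m). \<forall>x\<in>Q. f x = T x" if "subspace Q" "Q \<subseteq> C" for Q
    using that
  proof (induction "dim Q" arbitrary: Q rule: less_induct)
    case less
    show ?case
    proof (cases "Q = {0}")
      case True
      then show ?thesis using wspan_zero endo_zero[OF T(1)] by fastforce
    next
      case False
      then obtain e where e: "e \<in> Q" "e \<noteq> 0" using subspace_0[OF less.prems(1)] by blast
      have eC: "e \<in> C" using e less.prems by blast
      obtain b where b: "b \<in> wspan S ?m" "A (b e) \<noteq> 0"
        by (rule coorbit_full[OF eA x0 eC e(2)])
      have eAb: "endo (\<lambda>x. A (b x))"
        using endo_comp[OF eA wspan_is_endo[OF b(1)]] by (simp add: o_def)
      define u where "u = A (b e)"
      \<comment> \<open>The correction \<open>a \<circ> (A \<circ> b)\<close> vanishes on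
        \<open>Q'\<close>, so agreement there persists. As \<open>u\<close> spans the image of
        \<open>A\<close>, only the line through \<open>e\<close> remains, where \<open>a\<close> is
        chosen to map \<open>u\<close> to the defect of \<open>f'\<close>.\<close>
      define Q' where "Q' = {x\<in>Q. A (b x) = 0}"
      have sQ': "subspace Q'"
        using subspace_kernel_on[OF eAb less.prems(1)] by (simp add: Q'_def)
      have "Q' \<subset> Q" using b e by (auto simp: Q'_def)
      then have "dim Q' < dim Q"
        using fin_subspace_dim_less[OF fin_subspace_subset[OF fin_C less.prems] sQ'] by blast
      then obtain f' where f': "f' \<in> wspan S (k + 2 * ?m)" "\<forall>x\<in>Q'. f' x = T x"
        using less.hyps[of Q'] sQ' \<open>Q' \<subset> Q\<close> less.prems(2) by blast
      have ef': "endo f'" using f'(1) by (rule wspan_is_endo)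
      have uA: "u \<in> A ` C" using wspan_closed[OF b(1) eC] by (auto simp: u_def)
      have uC: "u \<in> C" using uA wspan_closed[OF A(1)] by auto
      have u0: "u \<noteq> 0" using b by (simp add: u_def)
      have Au: "A ` C \<subseteq> span {u}"
      proof -
        have "fin_subspace (A ` C)" using fin_subspace_image[OF fin_C eA] .
        moreover have "subspace (span {u})" by simp
        moreover have "span {u} \<subseteq> A ` C"
          using span_minimal[of "{u}" "A ` C"] uA subspace_endo_image[OF eA sub_C] by blast
        moreover have "dim (span {u}) = 1"
          using u0 dim_span_eq_card_independent[of "{u}"] by simp
        ultimately show ?thesis using fin_subspace_dim_eq[of "A ` C" "span {u}"] A(2) by simp
      qed
      have Te: "T e - f' e \<in> C"
        using T(2)[OF eC] wspan_closed[OF f'(1) eC] subspace_diff[OF sub_C] by blast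
      obtain a where a: "a \<in> wspan S ?m" "a u = T e - f' e"
        by (rule orbit_full[OF uC u0 Te])
      have ea: "endo a" using a(1) by (rule wspan_is_endo)
      have aAb: "a \<circ> (A \<circ> b) \<in> wspan S (?m + (k + ?m))"
        using wspan_comp[OF endo_letter a(1) wspan_comp[OF endo_letter A(1) b(1)]] .
      have "?m + (k + ?m) = k + 2 * ?m" by simp
      then have "a \<circ> (A \<circ> b) \<in> wspan S (k + 2 * ?m)" using aAb by (simp only:)
      then have "(\<lambda>x. f' x + (a \<circ> (A \<circ> b)) x) \<in> wspan S (k + 2 * ?m)"
        by (rule wspan.add[OF f'(1)])
      moreover have "f' x + (a \<circ> (A \<circ> b)) x = T x" if x: "x \<in> Q" for x
      proof -
        have "A (b x) \<in> A ` C" using wspan_closed[OF b(1)] x less.prems(2) by blast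
        then obtain c where c: "A (b x) = c *s u"
          using Au span_singleton[of u] by auto
        have "A (b (x - c *s e)) = 0"
          using c endo_diff[OF eAb] endo_scale[OF eAb] by (simp add: u_def)
        then have "x - c *s e \<in> Q'"
          using x e less.prems(1) by (simp add: Q'_def subspace_diff subspace_scale)
        then have "f' (x - c *s e) = T (x - c *s e)" using f'(2) by blast
        then have "f' x - c *s f' e = T x - c *s T e"
          by (simp add: endo_diff endo_scale ef' T(1))
        then have "f' x = T x - c *s T e + c *s f' e" by (simp add: algebra_simps)
        moreover have "a (A (b x)) = c *s (T e - f' e)" using c a(2) endo_scale[OF ea] by simp
        ultimately show ?thesis by (simp add: scale_right_diff_distrib)
      qed
      ultimately show ?thesis by (intro bexI[where x = "\<lambda>x. f' x + (a \<circ> (A \<circ> b)) x"] ballI)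
    qed
  qed
  from this[OF sub_C subset_refl] obtain f where "f \<in> wspan S (k + 2 * ?m)" "\<forall>x\<in>C. f x = T x" ..
  then show thesis using that[of f] by simp
qed

end

section \<open>Low-rank polynomials in an operator\<close>

locale alg_closed_operator_space = operator_space scale
  for scale :: "'a::alg_closed_field \<Rightarrow> 'b::ab_group_add \<Rightarrow> 'b" (infixr "*s" 75)
begin

text \<open>This is the vector p(B) u, by Horner's rule.\<close>

definition poly_app :: "('b \<Rightarrow> 'b) \<Rightarrow> 'a poly \<Rightarrow> 'b \<Rightarrow> 'b" where
  "poly_app B p u = fold_coeffs (\<lambda>a v. a *s u + B v) p 0"

lemma poly_app_0 [simp]: "poly_app B 0 u = 0"
  by (simp add: poly_app_def)

lemma poly_app_pCons: "endo B \<Longrightarrow> poly_app B (pCons a p) u = a *s u + B (poly_app B p u)"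
  by (cases "p = 0 \<and> a = 0") (auto simp: poly_app_def endo_zero)

lemma poly_app_add: "endo B \<Longrightarrow> poly_app B (p + q) u = poly_app B p u + poly_app B q u"
  by (induction p q rule: poly_induct2) (auto simp: poly_app_pCons endo_add scale_left_distrib)

lemma poly_app_smult: "endo B \<Longrightarrow> poly_app B (smult c p) u = c *s poly_app B p u"
  by (induction p) (auto simp: poly_app_pCons endo_scale scale_right_distrib)

lemma poly_app_linear_factor:
  assumes B: "endo B"
  shows "poly_app B ([:- c, 1:] * p) u = B (poly_app B p u) - c *s poly_app B p u"
proof -
  have "[:- c, 1:] * p = smult (- c) p + pCons 0 p" by simp
  then show ?thesis
    by (simp only: poly_app_add[OF B] poly_app_smult[OF B] poly_app_pCons[OF B]) simp
qed

lemma poly_app_sum: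
  assumes B: "endo B"
  shows "poly_app B (\<Sum>i\<in>I. f i) u = (\<Sum>i\<in>I. poly_app B (f i) u)"
  by (induction I rule: infinite_finite_induct) (auto simp: poly_app_add[OF B])

lemma poly_app_monom: "endo B \<Longrightarrow> poly_app B (Polynomial.monom c i) u = c *s (B ^^ i) u"
  by (induction i) (auto simp: monom_0 monom_Suc poly_app_pCons endo_scale endo_zero)

text \<open>Take \<open>p\<close> of least degree among the nonzero polynomials with p(B) u = 0 and
  split off a root \<open>c\<close>. The cofactor \<open>q\<close> has smaller degree, so q(B) u is
  a nonzero eigenvector.\<close>

lemma eigenvector_exists:
  assumes U: "fin_subspace U" "U \<noteq> {0}" and B: "endo B" "\<And>x. x \<in> U \<Longrightarrow> B x \<in> U"
  obtains x c where "x \<in> U" "x \<noteq> 0" "B x = c *s x"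
proof -
  have sU: "subspace U" using U(1) fin_subspaceD by blast
  obtain u where u: "u \<in> U" "u \<noteq> 0" using subspace_0[OF sU] U(2) by blast
  let ?v = "\<lambda>i. (B ^^ i) u"
  have vU: "?v i \<in> U" for i by (induction i) (auto simp: u B)
  have "\<exists>p. p \<noteq> 0 \<and> poly_app B p u = 0"
  \<comment> \<open>Dependence concerns sets, so a repetition among the iterates is treated apart;
    it yields the polynomial X^i - X^j.\<close>
  proof (cases "inj_on ?v {..dim U}")
    case False
    then obtain i j where ij: "i \<noteq> j" "?v i = ?v j" by (auto simp: inj_on_def)
    let ?p = "Polynomial.monom 1 i + Polynomial.monom (-1) j :: 'a poly"
    have "Polynomial.coeff ?p i \<noteq> 0" using ij by simp
    then have "?p \<noteq> 0" by (metis coeff_0)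
    moreover have "poly_app B ?p u = 0"
      using ij(2) by (simp only: poly_app_add[OF B(1)] poly_app_monom[OF B(1)]) simp
    ultimately show ?thesis by blast
  next
    case True
    then have "card (?v ` {..dim U}) = Suc (dim U)" by (simp add: card_image)
    then have "\<not> independent (?v ` {..dim U})"
      using independent_card_le[OF U(1), of "?v ` {..dim U}"] vU by auto
    then obtain w y where w: "(\<Sum>y\<in>?v ` {..dim U}. w y *s y) = 0" "y \<in> ?v ` {..dim U}" "w y \<noteq> 0"
      using dependent_finite[of "?v ` {..dim U}"] by auto
    then obtain k where k: "k \<le> dim U" "w (?v k) \<noteq> 0" by auto
    let ?p = "\<Sum>i\<le>dim U. Polynomial.monom (w (?v i)) i"
    have "Polynomial.coeff ?p k = w (?v k)" using k by (simp add: coeff_sum)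
    then have "?p \<noteq> 0" using k by auto
    moreover have "poly_app B ?p u = 0"
      using w(1) by (simp add: poly_app_sum[OF B(1)] poly_app_monom[OF B(1)] sum.reindex[OF True])
    ultimately show ?thesis by blast
  qed
  then obtain p where p: "p \<noteq> 0" "poly_app B p u = 0" and
    p_min: "\<And>q. Polynomial.degree q < Polynomial.degree p \<Longrightarrow> q \<noteq> 0 \<Longrightarrow> poly_app B q u \<noteq> 0"
    using exists_least_iff[of "\<lambda>n. \<exists>p. Polynomial.degree p = n \<and> p \<noteq> 0 \<and> poly_app B p u = 0"] by metis
  have "Polynomial.degree p > 0"
  proof (rule ccontr)
    assume "\<not> ?thesis"
    then obtain a where "p = [:a:]" using degree_eq_zeroE by blast
    then show False using p u by (simp add: poly_app_pCons B endo_zero)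
  qed
  then obtain c where "poly p c = 0" using alg_closed_imp_poly_has_root by blast
  then obtain q where q: "p = [:- c, 1:] * q" using poly_eq_0_iff_dvd by blast
  then have "q \<noteq> 0" using p by auto
  then have "Polynomial.degree q < Polynomial.degree p" using q by (simp add: degree_mult_eq del: mult_pCons_left)
  then have "poly_app B q u \<noteq> 0" using p_min \<open>q \<noteq> 0\<close> by blast
  moreover have "poly_app B q u \<in> U" for q
    by (induction q) (auto simp: poly_app_pCons B u sU subspace_0 subspace_add subspace_scale)
  moreover have "B (poly_app B q u) = c *s poly_app B q u"
    using p(2) unfolding q poly_app_linear_factor[OF B(1)] by simp
  ultimately show thesis using that by blast
qed

text \<open>Polynomials in \<open>B\<close> in factored form, given by the list of their roots with
  multiplicity, so that removing an entry drops a linear factor.\<close>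

definition shifts :: "('b \<Rightarrow> 'b) \<Rightarrow> 'a list \<Rightarrow> 'b \<Rightarrow> 'b" where
  "shifts B cs = foldr (\<lambda>c f x. B (f x) - c *s f x) cs id"

lemma shifts_Nil [simp]: "shifts B [] = id"
  and shifts_Cons [simp]: "shifts B (c # cs) x = B (shifts B cs x) - c *s shifts B cs x"
  by (simp_all add: shifts_def)

lemma shifts_append: "shifts B (cs @ ds) x = shifts B cs (shifts B ds x)"
  by (induction cs) auto

lemma endo_shifts: "endo B \<Longrightarrow> endo (shifts B cs)"
  by (induction cs) (auto simp: endo_iff algebra_simps scale_left_commute)

lemma shifts_closed:
  assumes "subspace U" "\<And>x. x \<in> U \<Longrightarrow> B x \<in> U"
  shows "x \<in> U \<Longrightarrow> shifts B cs x \<in> U"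
  by (induction cs) (auto simp: assms subspace_diff subspace_scale)

lemma shifts_commute_factor:
  assumes B: "endo B"
  shows "shifts B cs (B x - c *s x) = B (shifts B cs x) - c *s shifts B cs x"
proof (induction cs)
  case Nil
  then show ?case by simp
next
  case (Cons d cs)
  show ?case unfolding shifts_Cons Cons.IH
    by (simp add: endo_diff[OF B] endo_scale[OF B] algebra_simps scale_left_commute)
qed

lemma shifts_mset:
  assumes B: "endo B"
  shows "mset cs = mset ds \<Longrightarrow> shifts B cs = shifts B ds"
proof (induction cs arbitrary: ds)
  case Nil
  then show ?case by simp
next
  case (Cons c cs)
  then have "c \<in> set ds" by (metis list.set_intros(1) set_mset_mset)
  then obtain ds1 ds2 where ds: "ds = ds1 @ c # ds2" using split_list by metis
  then have "shifts B cs = shifts B (ds1 @ ds2)" using Cons by simp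
  then show ?case
    using ds by (auto simp: fun_eq_iff shifts_append shifts_commute_factor[OF B])
qed

text \<open>For an eigenvalue \<open>c\<close> the image of \<open>B - c\<close> is invariant and of
  smaller dimension. A list annihilating this image annihilates \<open>U\<close> once the factor for
  \<open>c\<close> is applied first.\<close>

lemma annihilating_shifts_exist:
  assumes "fin_subspace U" "endo B" "\<And>x. x \<in> U \<Longrightarrow> B x \<in> U"
  shows "\<exists>cs. \<forall>x\<in>U. shifts B cs x = 0"
  using assms(1,3)
proof (induction "dim U" arbitrary: U rule: less_induct)
  case less
  show ?case
  proof (cases "U = {0}")
    case True
    then show ?thesis by (intro exI[of _ "[]"]) simp
  next
    case False
    obtain x c where x: "x \<in> U" "x \<noteq> 0" "B x = c *s x"
      by (rule eigenvector_exists[OF less.prems(1) False assms(2) less.prems(2)])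
    let ?g = "\<lambda>x. B x - c *s x"
    have g: "endo ?g" using assms(2) by (rule endo_sub_scale)
    have sU: "subspace U" using less.prems(1) fin_subspaceD by blast
    have K: "subspace {x\<in>U. ?g x = 0}" using subspace_kernel_on[OF g sU] .
    have "x \<in> {x\<in>U. ?g x = 0}" using x by simp
    then have "0 < dim {x\<in>U. ?g x = 0}"
      using fin_subspace_dim_pos[OF fin_subspace_subset[OF less.prems(1) K]] x(2) by blast
    then have "dim (?g ` U) < dim U" using rank_nullity[OF less.prems(1) g] by linarith
    moreover have "fin_subspace (?g ` U)" using fin_subspace_image[OF less.prems(1) g] .
    moreover have "B y \<in> ?g ` U" if "y \<in> ?g ` U" for y
      using that less.prems(2) by (auto simp: endo_diff endo_scale assms(2) intro!: image_eqI)
    ultimately obtain cs where "\<forall>x\<in>?g ` U. shifts B cs x = 0" using less.hyps by blast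
    then have "\<forall>x\<in>U. shifts B (cs @ [c]) x = 0" by (simp add: shifts_append)
    then show ?thesis by blast
  qed
qed

text \<open>A shortest annihilating list \<open>ls\<close> plays the minimal polynomial, and
  \<open>c0\<close> is the root whose omission leaves the least rank. Every factor, in any order,
  then costs at least this rank, which bounds it against \<open>dim U\<close> and against the rank
  of a single \<open>B - c\<close>.\<close>

lemma low_rank_polynomial:
  assumes U: "fin_subspace U" and B: "endo B" "\<And>x. x \<in> U \<Longrightarrow> B x \<in> U"
    and nonscalar: "\<And>c. \<exists>x\<in>U. B x \<noteq> c *s x"
  obtains cs where "cs \<noteq> []" "0 < dim (shifts B cs ` U)"
    "Suc (length cs) * dim (shifts B cs ` U) \<le> dim U"
    "\<forall>c. length cs * dim (shifts B cs ` U) \<le> dim ((\<lambda>x. B x - c *s x) ` U)"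
proof -
  let ?null = "\<lambda>cs. \<forall>x\<in>U. shifts B cs x = 0"
  have sU: "subspace U" using U fin_subspaceD by blast
  have eS: "endo (shifts B cs)" for cs using B(1) by (rule endo_shifts)
  have SU: "shifts B cs ` U \<subseteq> U" for cs using shifts_closed[of U B, OF sU B(2)] by blast
  have fSU: "fin_subspace (shifts B cs ` U)" for cs using fin_subspace_image[OF U eS] .
  obtain ls where ls: "?null ls" and
    ls_min: "\<And>cs. length cs < length ls \<Longrightarrow> \<not> ?null cs"
    using exists_least_iff[of "\<lambda>n. \<exists>cs. length cs = n \<and> ?null cs"]
      annihilating_shifts_exist[OF U B] by metis
  obtain u where u: "u \<in> U" "u \<noteq> 0"
    using nonscalar[of 0] endo_zero[OF B(1)] by force
  \<comment> \<open>\<open>U\<close> is nonzero and \<open>B\<close> is not scalar on it, so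
    \<open>ls\<close> has at least two factors and stays nonempty after losing one.\<close>
  have "ls \<noteq> []" using ls u by auto
  moreover have "ls \<noteq> [c]" for c using ls nonscalar[of c] by auto
  ultimately have len: "2 \<le> length ls" by (cases ls; cases "tl ls") auto
  define r where "r c = dim (shifts B (remove1 c ls) ` U)" for c
  obtain c0 where c0: "c0 \<in> set ls" "\<And>c. c \<in> set ls \<Longrightarrow> r c0 \<le> r c"
    using ex_min_if_finite[of "r ` set ls"] len
    by (metis (no_types, lifting) arg_min_if_finite(1) arg_min_least finite_set list.size(3) not_numeral_le_zero set_empty)
  have rpos: "0 < r c" if "c \<in> set ls" for c
  proof -
    have "length (remove1 c ls) < length ls" using that len by (simp add: length_remove1)
    then obtain x where "x \<in> U" "shifts B (remove1 c ls) x \<noteq> 0" using ls_min by blast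
    then show ?thesis unfolding r_def using fin_subspace_dim_pos[OF fSU] by blast
  qed
  \<comment> \<open>Passing from \<open>xs\<close> to \<open>y # xs\<close> loses at least the rank of the product of all factors but \<open>y\<close>,
    since the image of that product lies in the image of \<open>shifts B xs\<close> and is killed by \<open>B - y\<close>.\<close>
  have chain: "length ys * r c0 \<le> dim (shifts B xs ` U)" if "mset (xs @ ys) = mset ls" for xs ys
    using that
  proof (induction ys arbitrary: xs)
    case Nil
    then show ?case by simp
  next
    case (Cons y ys)
    let ?g = "\<lambda>x. B x - y *s x" and ?I = "shifts B xs ` U"
    have g: "endo ?g" using B(1) by (rule endo_sub_scale)
    have yls: "y \<in> set ls" using Cons.prems by (metis in_set_conv_decomp set_mset_mset)
    have "mset ls = mset (xs @ y # ys)" using Cons.prems by (rule sym)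
    then have "mset (remove1 y ls) = mset (xs @ ys)" by simp
    then have rem: "shifts B (remove1 y ls) = shifts B (xs @ ys)" by (rule shifts_mset[OF B(1)])
    have sub: "shifts B (remove1 y ls) ` U \<subseteq> {x\<in>?I. ?g x = 0}"
    proof
      fix z assume "z \<in> shifts B (remove1 y ls) ` U"
      then obtain x where x: "x \<in> U" "z = shifts B (xs @ ys) x" using rem by auto
      have "z = shifts B xs (shifts B ys x)" using x(2) by (simp add: shifts_append)
      moreover have "shifts B ys x \<in> U" using SU x(1) by blast
      moreover have "?g z = shifts B (y # xs @ ys) x" using x(2) by simp
      moreover have "shifts B (y # xs @ ys) = shifts B ls"
        using Cons.prems by (intro shifts_mset[OF B(1)]) simp
      ultimately show "z \<in> {x\<in>?I. ?g x = 0}" using ls x(1) by auto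
    qed
    have "r c0 \<le> r y" using c0 yls by blast
    also have "\<dots> \<le> dim {x\<in>?I. ?g x = 0}"
      unfolding r_def
      using fin_subspace_dim_mono[OF fin_subspace_subset[OF fSU] fin_subspaceD[OF fSU] sub]
        subspace_kernel_on[OF g fin_subspaceD[OF fSU]] by auto
    finally have 1: "r c0 \<le> dim {x\<in>?I. ?g x = 0}" .
    have "shifts B (y # xs) ` U = ?g ` ?I" by (auto simp: image_image)
    moreover have "length ys * r c0 \<le> dim (shifts B (y # xs) ` U)"
      using Cons.IH[of "y # xs"] Cons.prems by simp
    ultimately show ?case using rank_nullity[OF fSU g, of xs] 1 by simp
  qed
  let ?cs = "remove1 c0 ls"
  have lencs: "length ls = Suc (length ?cs)" using c0(1) len by (simp add: length_remove1)
  have all: "length ls * r c0 \<le> dim U" using chain[of "[]" ls] by simp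
  have "length ?cs * r c0 \<le> dim ((\<lambda>x. B x - c *s x) ` U)" for c
  proof (cases "c \<in> set ls")
    case True
    then have "length (remove1 c ls) * r c0 \<le> dim (shifts B [c] ` U)"
      using chain[of "[c]" "remove1 c ls"] by simp
    moreover have "length (remove1 c ls) = length ?cs" using True c0 by (simp add: length_remove1)
    moreover have "shifts B [c] = (\<lambda>x. B x - c *s x)" by (simp add: fun_eq_iff)
    ultimately show ?thesis by simp
  next
    case False
    \<comment> \<open>For \<open>c\<close> outside \<open>ls\<close> the operator
      \<open>B - c\<close> is injective on \<open>U\<close>: an eigenvector for \<open>c\<close>
      would be multiplied by the nonzero product of all c - d, although \<open>ls\<close>
      annihilates it.\<close>
    have "x = 0" if "x \<in> U" "B x = c *s x" for x
    proof -
      have eig: "shifts B ds x = prod_list (map (\<lambda>d. c - d) ds) *s x" for ds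
        by (induction ds) (auto simp: endo_scale[OF B(1)] that(2) algebra_simps scale_left_diff_distrib)
      have "prod_list (map (\<lambda>d. c - d) ls) \<noteq> 0" using False by (auto simp: prod_list_zero_iff)
      then show ?thesis using eig[of ls] ls that(1) by simp
    qed
    then have "{x\<in>U. B x - c *s x = 0} = {0}"
      using subspace_0[OF sU] endo_zero[OF B(1)] by auto
    then have "dim ((\<lambda>x. B x - c *s x) ` U) = dim U"
      using rank_nullity[OF U endo_sub_scale[OF B(1)], of c] by simp
    then show ?thesis using all lencs by simp
  qed
  moreover have "?cs \<noteq> []" using lencs len by auto
  moreover have "0 < dim (shifts B ?cs ` U)" using rpos[OF c0(1)] by (simp add: r_def)
  ultimately show thesis using that[of ?cs] all lencs by (simp add: r_def)
qed

end

section \<open>Scalar actions and the length of a shortest nonscalar word\<close>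

context operator_space
begin

text \<open>Comparing the eigenvalues of a fixed \<open>x\<close>, of \<open>y\<close> and of
  \<open>x + y\<close> leaves two cases: they all agree, or \<open>y\<close> is a multiple of
  \<open>x\<close>.\<close>

lemma all_eigenvectors_imp_scalar:
  assumes Q: "subspace Q" and B: "endo B" and eig: "\<And>x. x \<in> Q \<Longrightarrow> \<exists>c. B x = c *s x"
  shows "\<exists>c. \<forall>x\<in>Q. B x = c *s x"
proof (cases "Q = {0}")
  case True
  then show ?thesis using B by (auto simp: endo_zero)
next
  case False
  then obtain x where x: "x \<in> Q" "x \<noteq> 0" using subspace_0[OF Q] by blast
  obtain c where c: "B x = c *s x" using eig x by blast
  have "B y = c *s y" if y: "y \<in> Q" for y
  proof -
    obtain d where d: "B y = d *s y" using eig y by blast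
    obtain e where "B (x + y) = e *s (x + y)" using eig Q x y subspace_add by blast
    then have e: "(e - c) *s x = (d - e) *s y"
      using c d endo_add[OF B] by (simp add: algebra_simps)
    show ?thesis
    proof (cases "d = e")
      case True
      then have "e = c" using e x by simp
      then show ?thesis using True d by simp
    next
      case False
      then have "y = ((e - c) / (d - e)) *s x"
        using e by (metis divide_inverse mult.commute nonzero_eq_divide_eq right_minus_eq
            scale_left_imp_eq scale_scale)
      then show ?thesis using c endo_scale[OF B] by (metis mult.commute scale_scale)
    qed
  qed
  then show ?thesis by blast
qed

lemma wspan_scalar:
  assumes A: "endo A" and f: "f \<in> wspan S k"
    and words: "\<And>vs. set vs \<subseteq> S \<Longrightarrow> length vs \<le> k \<Longrightarrow> \<exists>c. \<forall>u\<in>U. A (opword vs u) = c *s u"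
  shows "\<exists>c. \<forall>u\<in>U. A (f u) = c *s u"
  using f
proof (induction rule: wspan.induct)
  case (word ws)
  then show ?case using words by blast
next
  case (add f g)
  then obtain c d where "\<forall>u\<in>U. A (f u) = c *s u" "\<forall>u\<in>U. A (g u) = d *s u" by blast
  then show ?case by (intro exI[of _ "c + d"]) (simp add: endo_add[OF A] scale_left_distrib)
next
  case (scale f a)
  then obtain c where "\<forall>u\<in>U. A (f u) = c *s u" by blast
  then show ?case by (intro exI[of _ "a * c"]) (simp add: endo_scale[OF A])
qed

lemma independent_sum_eq_scale:
  assumes "independent B" "finite B" "u \<in> B" "(\<Sum>v\<in>B. a v *s v) = c *s u" "v \<in> B" "v \<noteq> u"
  shows "a v = 0"
proof -
  have "(\<Sum>w\<in>B. (a w - (if w = u then c else 0)) *s w) = (\<Sum>w\<in>B. a w *s w) - (\<Sum>w\<in>B. (if w = u then c *s w else 0))"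
    by (simp add: scale_left_diff_distrib sum_subtractf if_distrib[of "\<lambda>a. a *s _"] cong: if_cong)
  also have "\<dots> = 0" using assms(2-4) by simp
  finally have "(a v - (if v = u then c else 0)) = 0"
    using independentD[OF assms(1,2) subset_refl, where u = "\<lambda>w. a w - (if w = u then c else 0)"] assms(5)
    by simp
  then show ?thesis using assms(6) by simp
qed

end

context irreducible_ops
begin

lemma opword_endo: "set ws \<subseteq> S \<Longrightarrow> endo (opword ws)"
  using endo_opword endo_letter by blast

lemma opword_closed: "set ws \<subseteq> S \<Longrightarrow> x \<in> C \<Longrightarrow> opword ws x \<in> C"
  using opword_invariant letter_closed by blast

text \<open>The potential dim (V i) + dim (K (L - i)) gains at least \<open>r\<close> with each of
  the \<open>L\<close> letters, yet both spaces lie in \<open>C\<close>, so it never exceeds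
  \<open>2 * dim C\<close>.\<close>

lemma nonscalar_length_bound:
  assumes A: "endo A" "\<And>x. x \<in> C \<Longrightarrow> A x \<in> C" and ws: "set ws \<subseteq> S"
    and words: "\<And>vs. set vs \<subseteq> S \<Longrightarrow> length vs < length ws \<Longrightarrow>
      \<exists>c. \<forall>u\<in>A ` C. A (opword vs u) = c *s u"
    and rank: "\<And>c. r \<le> dim ((\<lambda>u. A (opword ws u) - c *s u) ` (A ` C))"
  shows "length ws * r \<le> 2 * dim C"
proof -
  define U where "U = A ` C"
  define L where "L = length ws"
  define V where "V i = span {f u |f u. f \<in> wspan S i \<and> u \<in> U}" for i
  define K where "K j = {x\<in>C. \<forall>vs. set vs \<subseteq> S \<and> length vs < j \<longrightarrow> A (opword vs x) = 0}" for j
  have fU: "fin_subspace U" unfolding U_def using fin_subspace_image[OF fin_C A(1)] .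
  have sU: "subspace U" using fU fin_subspaceD by blast
  have UC: "U \<subseteq> C" using A(2) by (auto simp: U_def)
  have sV: "subspace (V i)" for i by (simp add: V_def)
  have V_base: "f u \<in> V i" if "f \<in> wspan S i" "u \<in> U" for f u i
    unfolding V_def using that by (intro span_base) blast
  have VC: "V i \<subseteq> C" for i
    unfolding V_def by (rule span_minimal) (use wspan_closed UC sub_C in auto)
  have V_Suc: "V i \<subseteq> V (Suc i)" for i
    unfolding V_def by (rule span_mono) (use wspan_mono[of _ S i "Suc i"] in auto)
  have KC: "K j \<subseteq> C" for j by (auto simp: K_def)
  have sK: "subspace (K j)" for j
  proof (rule subspaceI)
    show "0 \<in> K j"
      by (auto simp: K_def A endo_zero opword_endo subspace_0 sub_C)
    show "x + y \<in> K j" if "x \<in> K j" "y \<in> K j" for x y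
      using that by (auto simp: K_def A(1) endo_add opword_endo subspace_add sub_C)
    show "c *s x \<in> K j" if "x \<in> K j" for c x
      using that by (auto simp: K_def A(1) endo_scale opword_endo subspace_scale sub_C)
  qed
  have K_Suc: "K (Suc j) \<subseteq> K j" for j by (auto simp: K_def)
  have fV: "fin_subspace (V i)" for i using fin_subspace_subset[OF fin_C sV VC] .
  have fK: "fin_subspace (K i)" for i using fin_subspace_subset[OF fin_C sK KC] .
  have scalar: "\<exists>c. \<forall>u\<in>U. A (f u) = c *s u" if "f \<in> wspan S k" "k < L" for f k
    by (rule wspan_scalar[OF A(1) that(1)]) (use words that(2) in \<open>auto simp: U_def L_def\<close>)
  have scalar': "\<exists>c. \<forall>u\<in>U. A (opword vs (f u)) = c *s u"
    if "f \<in> wspan S i" "set vs \<subseteq> S" "length vs + i < L" for f i vs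
    using scalar[OF wspan_comp[OF endo_letter wspan.word[OF that(2) order_refl] that(1)] that(3)]
    by simp
  \<comment> \<open>The scalar 0 bounds \<open>r\<close> by \<open>dim U\<close>, which is needed
    where \<open>K\<close> loses a copy of \<open>U\<close>.\<close>
  have "r \<le> dim ((\<lambda>u. A (opword ws u) - 0 *s u) ` U)" using rank[of 0] by (simp add: U_def)
  also have "\<dots> \<le> dim U"
    by (rule dim_image_le_on[OF fU endo_sub_scale])
      (use endo_comp[OF A(1) opword_endo[OF ws]] in \<open>simp add: o_def\<close>)
  finally have rU: "r \<le> dim U" .
  \<comment> \<open>Each letter of \<open>ws\<close> either enlarges the span \<open>V\<close> of what is reachable from \<open>U\<close>, or shrinks the
    space \<open>K j\<close> of vectors that \<open>A\<close> kills after fewer than \<open>j\<close> letters, by at least \<open>r\<close> dimensions.\<close>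
  have step: "dim (V i) + dim (K (Suc j)) + r \<le> dim (V (Suc i)) + dim (K j)" if ij: "i + j + 1 = L" for i j
  proof (cases "\<exists>f\<in>wspan S i. f ` U \<subseteq> K j \<and> \<not> f ` U \<subseteq> K (Suc j)")
    case True
    then obtain f u0 where f: "f \<in> wspan S i" "f ` U \<subseteq> K j" and u0: "u0 \<in> U" "f u0 \<notin> K (Suc j)"
      by blast
    have ef: "endo f" using f(1) by (rule wspan_is_endo)
    have "f u0 \<in> C" using f(2) u0(1) KC by blast
    then obtain vs where vs: "set vs \<subseteq> S" "length vs < Suc j" "A (opword vs (f u0)) \<noteq> 0"
      using u0(2) by (auto simp: K_def)
    \<comment> \<open>\<open>vs\<close> has at most \<open>j\<close> letters and i + j + 1 = L, so
      the composite stays below length \<open>L\<close> and acts on \<open>U\<close> by one scalar.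
      It is nonzero at \<open>u0\<close>; hence \<open>f\<close> embeds \<open>U\<close> into K j
      modulo K (Suc j).\<close>
    obtain c where c: "\<forall>u\<in>U. A (opword vs (f u)) = c *s u"
      using scalar'[OF f(1) vs(1)] vs(2) ij by force
    then have "c \<noteq> 0" using vs(3) u0(1) by auto
    then have "u = 0" if "u \<in> U" "f u \<in> K (Suc j)" for u
      using that vs c by (auto simp: K_def)
    then have "{u\<in>U. f u \<in> K (Suc j)} = {0}"
      using subspace_0[OF sU] subspace_0[OF sK] endo_zero[OF ef] by auto
    then have "dim (K (Suc j)) + dim U \<le> dim (K j)"
      using dim_extend[OF fU fK[of j] sK K_Suc ef f(2)] by simp
    moreover have "dim (V i) \<le> dim (V (Suc i))"
      using fin_subspace_dim_mono[OF fV sV V_Suc] .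
    ultimately show ?thesis using rU by linarith
  next
    case False
    then have stable: "f ` U \<subseteq> K (Suc j)" if "f \<in> wspan S i" "f ` U \<subseteq> K j" for f
      using that by blast
    define bs where "bs = take j ws"
    define s where "s = ws ! j"
    define as where "as = drop (Suc j) ws"
    have split: "ws = bs @ s # as"
      using id_take_nth_drop[of j ws] ij by (simp add: L_def bs_def s_def as_def)
    have lens: "length bs = j" "length as = i" using ij by (auto simp: L_def bs_def as_def)
    have bsS: "set bs \<subseteq> S" using split ws by auto
    define g where "g = opword (s # as)"
    have g: "g \<in> wspan S (Suc i)"
      unfolding g_def by (rule wspan.word) (use split ws lens in auto)
    have eg: "endo g" using g by (rule wspan_is_endo)
    define B where "B x = A (opword ws x)" for x
    have eB: "endo B"
      using endo_comp[OF A(1) opword_endo[OF ws]] by (simp add: B_def[abs_def] o_def)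
    have Bg: "B x = A (opword bs (g x))" for x
      by (simp add: B_def g_def split opword_append)
    \<comment> \<open>It suffices that \<open>B\<close> is scalar on \<open>U'\<close>: then
      \<open>U'\<close> has codimension at least \<open>r\<close> in \<open>U\<close>, and
      \<open>g\<close> embeds U/U' into V (Suc i) modulo V i.\<close>
    define U' where "U' = {u\<in>U. g u \<in> V i}"
    have sU': "subspace U'"
      unfolding U'_def using subspace_preimage_on[OF eg sU sV] .
    \<comment> \<open>Writing \<open>g u = (\<Sum>v. a v v)\<close> over a basis containing \<open>u\<close>, words shorter than \<open>bs\<close> act by
      scalars, so for \<open>v \<noteq> u\<close> the operator \<open>a v\<close> sends \<open>U\<close> into \<open>K j\<close>, hence into \<open>K (Suc j)\<close>, and only
      \<open>a u\<close> contributes to \<open>B u\<close>.\<close>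
    have "\<exists>c. B u = c *s u" if u: "u \<in> U'" for u
    proof (cases "u = 0")
      case True
      then show ?thesis using endo_zero[OF eB] by simp
    next
      case False
      have uU: "{u} \<subseteq> U" using u by (simp add: U'_def)
      have "independent {u}" using False by simp
      then obtain E where E: "{u} \<subseteq> E" "E \<subseteq> U" "independent E" "finite E" "span E = U" "card E = dim U"
        by (rule fin_subspace_basis_extend[OF fU _ uU])
      have uE: "u \<in> E" using E by simp
      \<comment> \<open>With operators as coefficients, the single basis \<open>E\<close> serves all
        of \<open>V i\<close>: by linearity, f w expands over \<open>E\<close> with multiples of
        \<open>f\<close> as coefficients.\<close>
      define V' where "V' = {(\<Sum>v\<in>E. a v v) |a. \<forall>v. a v \<in> wspan S i}"
      have V'D: "\<exists>a. x = (\<Sum>v\<in>E. a v v) \<and> (\<forall>v. a v \<in> wspan S i)" if "x \<in> V'" for x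
        using that by (simp add: V'_def)
      have "V i \<subseteq> V'" unfolding V_def
      proof (rule span_minimal)
        show "subspace V'"
        proof (rule subspaceI)
          show "0 \<in> V'" unfolding V'_def
            using wspan_zero[of S i] by (intro CollectI exI[of _ "\<lambda>v x. 0"]) simp
          show "x + y \<in> V'" if "x \<in> V'" "y \<in> V'" for x y
          proof -
            from V'D[OF that(1)] obtain a where
              a: "x = (\<Sum>v\<in>E. a v v) \<and> (\<forall>v. a v \<in> wspan S i)" ..
            from V'D[OF that(2)] obtain b where
              b: "y = (\<Sum>v\<in>E. b v v) \<and> (\<forall>v. b v \<in> wspan S i)" ..
            from a b show ?thesis unfolding V'_def
              by (intro CollectI exI[of _ "\<lambda>v x. a v x + b v x"]) (auto simp: sum.distrib wspan.add)
          qed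
          show "c *s x \<in> V'" if "x \<in> V'" for c x
          proof -
            from V'D[OF that] obtain a where "x = (\<Sum>v\<in>E. a v v) \<and> (\<forall>v. a v \<in> wspan S i)" ..
            then show ?thesis unfolding V'_def
              by (intro CollectI exI[of _ "\<lambda>v x. c *s a v x"]) (auto simp: scale_sum_right wspan.scale)
          qed
        qed
        show "{f u |f u. f \<in> wspan S i \<and> u \<in> U} \<subseteq> V'"
        proof clarify
          fix f w assume f: "f \<in> wspan S i" and w: "w \<in> U"
          then have "w \<in> span E" using E(5) by simp
          then obtain x where x: "w = (\<Sum>v\<in>E. x v *s v)" using span_finite[OF E(4)] by auto
          have "f w = (\<Sum>v\<in>E. x v *s f v)"
            unfolding x by (simp add: endo_sum endo_scale wspan_is_endo[OF f])
          then show "f w \<in> V'" unfolding V'_def using f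
            by (intro CollectI exI[of _ "\<lambda>v y. x v *s f y"]) (auto simp: wspan.scale)
        qed
      qed
      then have "g u \<in> V'" using u by (auto simp: U'_def)
      from V'D[OF this] obtain a where "g u = (\<Sum>v\<in>E. a v v) \<and> (\<forall>v. a v \<in> wspan S i)" ..
      then have a: "g u = (\<Sum>v\<in>E. a v v)" "\<And>v. a v \<in> wspan S i" by auto
      have expand: "A (opword vs (g u)) = (\<Sum>v\<in>E. A (opword vs (a v v)))" if "set vs \<subseteq> S" for vs
        unfolding a(1) using that by (simp add: endo_sum A(1) opword_endo)
      have "a v ` U \<subseteq> K j" if v: "v \<in> E" "v \<noteq> u" for v
      proof -
        have "A (opword vs (a v w)) = 0" if vs: "set vs \<subseteq> S" "length vs < j" and w: "w \<in> U" for vs w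
        proof -
          have "\<exists>c. \<forall>w\<in>U. A (opword vs (a v w)) = c *s w" for v
            using scalar'[OF a(2) vs(1)] vs(2) ij by simp
          then obtain c where c: "\<And>v w. w \<in> U \<Longrightarrow> A (opword vs (a v w)) = c v *s w" by metis
          obtain d where "A (opword vs (g u)) = d *s u"
            using scalar'[OF g vs(1)] vs(2) ij uU by force
          moreover have "(\<Sum>v\<in>E. A (opword vs (a v v))) = (\<Sum>v\<in>E. c v *s v)"
            using c E(2) by (intro sum.cong) auto
          ultimately have "(\<Sum>v\<in>E. c v *s v) = d *s u" using expand[OF vs(1)] by simp
          then have "c v = 0" using independent_sum_eq_scale[OF E(3,4) uE _ v] by blast
          then show ?thesis using c w by simp
        qed
        then show ?thesis using wspan_closed[OF a(2)] UC by (auto simp: K_def)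
      qed
      then have "a v ` U \<subseteq> K (Suc j)" if "v \<in> E" "v \<noteq> u" for v
        using stable[OF a(2)] that by blast
      then have "A (opword bs (a v v)) = 0" if "v \<in> E" "v \<noteq> u" for v
        using that E(2) bsS lens(1) by (auto simp: K_def)
      then have "(\<Sum>v\<in>E. A (opword bs (a v v))) = (\<Sum>v\<in>{u}. A (opword bs (a v v)))"
        using uE E(4) by (intro sum.mono_neutral_right) auto
      then have "B u = A (opword bs (a u u))"
        using Bg expand[OF bsS] by simp
      moreover obtain c where "\<forall>w\<in>U. A (opword bs (a u w)) = c *s w"
        using scalar'[OF a(2) bsS] lens ij by force
      ultimately show ?thesis using uU by auto
    qed
    then obtain c where c: "\<forall>u\<in>U'. B u = c *s u"
      using all_eigenvectors_imp_scalar[OF sU' eB] by blast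
    let ?h = "\<lambda>u. B u - c *s u"
    have eh: "endo ?h" using eB by (rule endo_sub_scale)
    have "U' \<subseteq> {u\<in>U. ?h u = 0}" using c by (auto simp: U'_def)
    then have "dim U' \<le> dim {u\<in>U. ?h u = 0}"
      using fin_subspace_dim_mono[OF fin_subspace_subset[OF fU] sU'] subspace_kernel_on[OF eh sU] by auto
    moreover have "r \<le> dim (?h ` U)" using rank[of c] by (simp add: B_def U_def)
    ultimately have "r + dim U' \<le> dim U" using rank_nullity[OF fU eh] by linarith
    moreover have "dim (V i) + dim U \<le> dim (V (Suc i)) + dim U'"
      unfolding U'_def using dim_extend[OF fU fV sV V_Suc eg] V_base[OF g] by blast
    moreover have "dim (K (Suc j)) \<le> dim (K j)"
      using fin_subspace_dim_mono[OF fK sK K_Suc] .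
    ultimately show ?thesis by linarith
  qed
  have "i \<le> L \<Longrightarrow> i * r \<le> dim (V i) + dim (K (L - i))" for i
  proof (induction i)
    case 0
    show ?case by simp
  next
    case (Suc i)
    then have "dim (V i) + dim (K (L - i)) + r \<le> dim (V (Suc i)) + dim (K (L - Suc i))"
      using step[of i "L - Suc i"] by (simp add: Suc_diff_Suc)
    then show ?case using Suc by simp
  qed
  from this[of L] have "L * r \<le> dim (V L) + dim (K 0)" by simp
  also have "\<dots> \<le> dim C + dim C"
    using fin_subspace_dim_mono[OF fin_C sV VC] fin_subspace_dim_mono[OF fin_C sK KC] by (rule add_mono)
  finally show ?thesis by (simp add: L_def)
qed

end

section \<open>Rank reduction\<close>

locale alg_closed_irreducible_ops =
  irreducible_ops scale S C + alg_closed_operator_space scale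
  for scale :: "'a::alg_closed_field \<Rightarrow> 'b::ab_group_add \<Rightarrow> 'b" (infixr "*s" 75) and S C
begin

text \<open>Otherwise a nonzero \<open>u\<close> in the image of \<open>A\<close> would have all A
  (f u) on its own line. The vectors f u fill \<open>C\<close>, so \<open>A\<close> would have rank
  at most one.\<close>

lemma nonscalar_word_exists:
  assumes A: "A \<in> wspan S k" and rank: "2 \<le> dim (A ` C)"
  shows "\<exists>ws. set ws \<subseteq> S \<and> \<not> (\<exists>c. \<forall>u\<in>A ` C. A (opword ws u) = c *s u)"
proof (rule ccontr)
  assume "\<not> ?thesis"
  then have scalar: "\<exists>c. \<forall>u\<in>A ` C. A (f u) = c *s u" if "f \<in> wspan S l" for f l
    using wspan_scalar[OF wspan_is_endo[OF A] that] by blast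
  have "A ` C \<noteq> {0}" using rank by auto
  moreover have "0 \<in> A ` C"
    using subspace_0[OF subspace_endo_image[OF wspan_is_endo[OF A] sub_C]] .
  ultimately obtain u where u: "u \<in> A ` C" "u \<noteq> 0" by blast
  have uC: "u \<in> C" using u(1) wspan_closed[OF A] by blast
  have "A ` C \<subseteq> span {u}"
  proof
    fix y assume "y \<in> A ` C"
    then obtain x where x: "x \<in> C" "y = A x" by blast
    obtain f where f: "f \<in> wspan S (dim C - 1)" "f u = x" by (rule orbit_full[OF uC u(2) x(1)])
    then have "\<exists>c. y = c *s u" using scalar[OF f(1)] u(1) x(2) by auto
    then show "y \<in> span {u}" by (auto simp: span_singleton)
  qed
  then have "dim (A ` C) \<le> 1" using dim_le_card[of "A ` C" "{u}"] by simp
  then show False using rank by simp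
qed

lemma rank_reduction:
  assumes A: "A \<in> wspan S k" and rank: "2 \<le> dim (A ` C)"
  obtains A' k' where "A' \<in> wspan S k'" "0 < dim (A' ` C)" "2 * dim (A' ` C) \<le> dim (A ` C)"
    "k' * dim (A' ` C) \<le> k * dim (A ` C) + 2 * dim C"
proof -
  have eA: "endo A" using A by (rule wspan_is_endo)
  let ?U = "A ` C"
  let ?scalar = "\<lambda>ws. \<exists>c. \<forall>u\<in>?U. A (opword ws u) = c *s u"
  have fU: "fin_subspace ?U" using fin_subspace_image[OF fin_C eA] .
  have UC: "?U \<subseteq> C" using wspan_closed[OF A] by blast
  have "\<exists>L ws. length ws = L \<and> set ws \<subseteq> S \<and> \<not> ?scalar ws"
    using nonscalar_word_exists[OF A rank] by blast
  then obtain ws where ws: "set ws \<subseteq> S" "\<not> ?scalar ws" and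
    ws_min: "\<And>vs. set vs \<subseteq> S \<Longrightarrow> length vs < length ws \<Longrightarrow> ?scalar vs"
    using exists_least_iff[of "\<lambda>L. \<exists>ws. length ws = L \<and> set ws \<subseteq> S \<and> \<not> ?scalar ws"] by metis
  define B where "B x = A (opword ws x)" for x
  have eB: "endo B"
    using endo_comp[OF eA opword_endo[OF ws(1)]] by (simp add: B_def[abs_def] o_def)
  have BU: "B x \<in> ?U" if "x \<in> ?U" for x
    using that UC opword_closed[OF ws(1)] by (auto simp: B_def)
  have nonscalar: "\<exists>x\<in>?U. B x \<noteq> c *s x" for c using ws(2) by (auto simp: B_def)
  obtain cs where cs: "cs \<noteq> []" "0 < dim (shifts B cs ` ?U)"
    "Suc (length cs) * dim (shifts B cs ` ?U) \<le> dim ?U"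
    "\<forall>c. length cs * dim (shifts B cs ` ?U) \<le> dim ((\<lambda>x. B x - c *s x) ` ?U)"
    by (rule low_rank_polynomial[OF fU eB BU nonscalar])
  define \<rho> where "\<rho> = dim (shifts B cs ` ?U)"
  define A' where "A' = shifts B cs \<circ> A"
  have "length ws * (length cs * \<rho>) \<le> 2 * dim C"
    using cs(4) by (intro nonscalar_length_bound[OF eA wspan_closed[OF A] ws(1) ws_min]) (auto simp: \<rho>_def B_def)
  have Bk: "B \<in> wspan S (k + length ws)"
    using wspan_comp[OF endo_letter A wspan.word[OF ws(1) order_refl]] by (simp add: B_def[abs_def] o_def)
  have A'k: "shifts B ds \<circ> A \<in> wspan S (k + length ds * (k + length ws))" for ds
  proof (induction ds)
    case Nil
    then show ?case using A by simp
  next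
    case (Cons d ds)
    let ?l = "k + length (d # ds) * (k + length ws)"
    have "B \<circ> (shifts B ds \<circ> A) \<in> wspan S ((k + length ws) + (k + length ds * (k + length ws)))"
      using wspan_comp[OF endo_letter Bk Cons] .
    then have "B \<circ> (shifts B ds \<circ> A) \<in> wspan S ?l" by (simp add: algebra_simps)
    moreover have "(\<lambda>x. d *s (shifts B ds \<circ> A) x) \<in> wspan S ?l"
      using wspan.scale[OF wspan_mono[OF Cons, of ?l]] by simp
    ultimately have "(\<lambda>x. (B \<circ> (shifts B ds \<circ> A)) x - d *s (shifts B ds \<circ> A) x) \<in> wspan S ?l"
      by (rule wspan_diff)
    then show ?case by (simp add: o_def)
  qed
  have img: "A' ` C = shifts B cs ` ?U" by (auto simp: A'_def)
  show thesis
  proof (rule that[of A' "k + length cs * (k + length ws)"])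
    show "A' \<in> wspan S (k + length cs * (k + length ws))" unfolding A'_def by (rule A'k)
    show "0 < dim (A' ` C)" using cs(2) img by simp
    have "2 * \<rho> \<le> Suc (length cs) * \<rho>" using cs(1) by (intro mult_right_mono) (cases cs; auto)+
    also have "\<dots> \<le> dim ?U" using cs(3) by (simp only: \<rho>_def)
    finally show "2 * dim (A' ` C) \<le> dim ?U" by (simp only: img \<rho>_def)
    \<comment> \<open>The first summand is controlled by the rank of \<open>A\<close>, since
      \<open>Suc (length cs) * \<rho>\<close> is at most this rank; the second is controlled by the
      bound on nonscalar words.\<close>
    have "(k + length cs * (k + length ws)) * \<rho> = k * (Suc (length cs) * \<rho>) + length ws * (length cs * \<rho>)"
      by (simp add: algebra_simps)
    also have "\<dots> \<le> k * dim ?U + 2 * dim C"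
      using cs(3) \<open>length ws * _ \<le> _\<close> by (intro add_mono mult_left_mono) (auto simp: \<rho>_def)
    finally show "(k + length cs * (k + length ws)) * dim (A' ` C) \<le> k * dim ?U + 2 * dim C"
      by (simp add: img \<rho>_def)
  qed
qed

text \<open>Halving the rank raises the logarithm by at least 1, so the right side of the invariant
  gains \<open>2 * dim C\<close>, exactly what \<open>rank_reduction\<close> may add on the
  left.\<close>

lemma rank_one_element_from:
  assumes "A \<in> wspan S k" "0 < dim (A ` C)"
    "real k * real (dim (A ` C)) \<le> 2 * real (dim C) * log 2 (real (dim C) / real (dim (A ` C)))"
  shows "\<exists>A k. A \<in> wspan S k \<and> dim (A ` C) = 1 \<and> real k \<le> 2 * real (dim C) * log 2 (real (dim C))"
  using assms
proof (induction "dim (A ` C)" arbitrary: A k rule: less_induct)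
  case less
  let ?r = "dim (A ` C)" and ?n = "real (dim C)"
  show ?case
  proof (cases "?r = 1")
    case True
    then show ?thesis using less.prems by auto
  next
    case False
    then have "2 \<le> ?r" using less.prems(2) by linarith
    then obtain A' k' where A': "A' \<in> wspan S k'" "0 < dim (A' ` C)" "2 * dim (A' ` C) \<le> ?r"
      "k' * dim (A' ` C) \<le> k * ?r + 2 * dim C"
      by (rule rank_reduction[OF less.prems(1)])
    let ?r' = "dim (A' ` C)"
    have "real k' * real ?r' \<le> real k * real ?r + 2 * ?n"
      using A'(4) by (metis (mono_tags, lifting) of_nat_add of_nat_le_iff of_nat_mult of_nat_numeral)
    also have "\<dots> \<le> 2 * ?n * (log 2 (?n / real ?r) + 1)"
      using less.prems(3) by (simp add: algebra_simps)
    also have "log 2 (?n / real ?r) + 1 = log 2 (2 * ?n / real ?r)"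
      using less.prems(2) dim_C_pos by (simp add: log_mult log_divide)
    also have "\<dots> \<le> log 2 (?n / real ?r')"
    proof -
      have "2 * ?n / real ?r \<le> ?n / real ?r'"
      proof -
        have "2 * real ?r' \<le> real ?r" using A'(3) by (metis of_nat_le_iff of_nat_mult of_nat_numeral)
        then have "?n * (2 * real ?r') \<le> ?n * real ?r" by (intro mult_left_mono) auto
        then show ?thesis using less.prems(2) A'(2) by (simp add: field_simps)
      qed
      then show ?thesis using less.prems(2) A'(2) dim_C_pos by simp
    qed
    finally have "real k' * real ?r' \<le> 2 * ?n * log 2 (?n / real ?r')"
      by (simp add: mult_left_mono)
    moreover have "?r' < ?r" using A'(2,3) by linarith
    ultimately show ?thesis using less.hyps A'(1,2) by blast
  qed
qed

text \<open>A rank-one element costs 2 n log n and spanning from it 2 (n - 1), where n is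
  \<open>dim C\<close>. Lengths are integers, so a length below \<open>m + 1\<close> is at most
  \<open>m\<close>.\<close>

lemma irreducible_length:
  assumes T: "endo T" "\<And>x. x \<in> C \<Longrightarrow> T x \<in> C"
    and m: "2 * real (dim C) * log 2 (real (dim C)) + 2 * real (dim C) - 2 < real m + 1"
  obtains f where "f \<in> wspan S m" "\<And>x. x \<in> C \<Longrightarrow> f x = T x"
proof -
  have "\<exists>A k. A \<in> wspan S k \<and> dim (A ` C) = 1 \<and> real k \<le> 2 * real (dim C) * log 2 (real (dim C))"
    \<comment> \<open>The identity starts the descent: it has length 0 and full rank, and log 1 =
      0.\<close>
    by (rule rank_one_element_from[of id 0]) (use wspan_id dim_C_pos in auto)
  then obtain A k where A: "A \<in> wspan S k" "dim (A ` C) = 1"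
    "real k \<le> 2 * real (dim C) * log 2 (real (dim C))" by blast
  obtain f where f: "f \<in> wspan S (k + 2 * (dim C - 1))" "\<And>x. x \<in> C \<Longrightarrow> f x = T x"
    using rank_one_spans[OF A(1,2) T] by metis
  have "real (k + 2 * (dim C - 1)) < real (m + 1)"
    using A(3) m dim_C_pos by (simp add: of_nat_diff Suc_le_eq)
  then have "k + 2 * (dim C - 1) \<le> m" by linarith
  then have "f \<in> wspan S m" using wspan_mono[OF f(1)] by blast
  then show thesis using f(2) that by metis
qed

end

section \<open>Reduction to irreducible quotients\<close>

text \<open>The constants on the left add up to -3 against -2 on the right, so the 1 lost in joining
  two quotients is absorbed. The rest is monotonicity of the logarithm.\<close>

lemma length_majorant_superadditive:
  assumes "1 \<le> a" "1 \<le> b"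
  shows "(2 * a * log 2 a + 2 * a - 2) + (2 * b * log 2 b + 2 * b - 2) + 1
    \<le> 2 * (a + b) * log 2 (a + b) + 2 * (a + b) - 2"
proof -
  have "a * log 2 a \<le> a * log 2 (a + b)" "b * log 2 b \<le> b * log 2 (a + b)"
    using assms by (auto intro!: mult_left_mono)
  then show ?thesis by (simp add: algebra_simps)
qed

context operator_space
begin

text \<open>For invariant \<open>V\<close> and \<open>W\<close> this means length at most
  \<open>m\<close> on V/W: words of exactly \<open>Suc m\<close> letters suffice, since a longer
  word is shortened through such a factor.\<close>

definition length_bound :: "('b \<Rightarrow> 'b) set \<Rightarrow> 'b set \<Rightarrow> 'b set \<Rightarrow> nat \<Rightarrow> bool" where
  "length_bound S V W m \<longleftrightarrow>
    (\<forall>ws. set ws \<subseteq> S \<and> length ws = Suc m \<longrightarrow> (\<exists>f\<in>wspan S m. \<forall>x\<in>V. opword ws x - f x \<in> W))"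

text \<open>Split a word as w1 w2, with w1 of length m + 1 acting last. Then (w1 - f) (w2 - g) maps
  \<open>V\<close> through \<open>W\<close> into \<open>Z\<close>, and expanding it expresses w1 w2
  by f w2, w1 g and f g, all of length at most l + m + 1.\<close>

lemma length_bound_trans:
  assumes S: "\<And>s. s \<in> S \<Longrightarrow> endo s"
    and VW: "length_bound S V W l" and WZ: "length_bound S W Z m"
  shows "length_bound S V Z (Suc (l + m))"
  unfolding length_bound_def
proof (intro allI impI)
  fix ws assume ws: "set ws \<subseteq> S \<and> length ws = Suc (Suc (l + m))"
  let ?ws1 = "take (Suc m) ws" and ?ws2 = "drop (Suc m) ws"
  have s1: "set ?ws1 \<subseteq> S" and s2: "set ?ws2 \<subseteq> S"
    using ws set_take_subset set_drop_subset by fast+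
  have l1: "length ?ws1 = Suc m" and l2: "length ?ws2 = Suc l" using ws by auto
  obtain f where f: "f \<in> wspan S m" "\<forall>x\<in>W. opword ?ws1 x - f x \<in> Z"
    using WZ s1 l1 unfolding length_bound_def by blast
  obtain g where g: "g \<in> wspan S l" "\<forall>x\<in>V. opword ?ws2 x - g x \<in> W"
    using VW s2 l2 unfolding length_bound_def by blast
  let ?w1 = "opword ?ws1" and ?w2 = "opword ?ws2"
  have w: "opword ws x = ?w1 (?w2 x)" for x
    using opword_append[of ?ws1 ?ws2] by simp
  have e1: "endo ?w1" using endo_opword s1 S by blast
  have ef: "endo f" using wspan_endo[OF f(1)] S by blast
  let ?h = "\<lambda>x. ((f \<circ> ?w2) x + (?w1 \<circ> g) x) - (f \<circ> g) x"
  have "?h \<in> wspan S (Suc (l + m))"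
  proof (intro wspan_diff wspan.add)
    show "f \<circ> ?w2 \<in> wspan S (Suc (l + m))"
      using wspan_mono[OF wspan_comp[OF S f(1) wspan.word[OF s2 order_refl]]] l2 by simp
    show "?w1 \<circ> g \<in> wspan S (Suc (l + m))"
      using wspan_mono[OF wspan_comp[OF S wspan.word[OF s1 order_refl] g(1)]] l1 by simp
    show "f \<circ> g \<in> wspan S (Suc (l + m))"
      using wspan_mono[OF wspan_comp[OF S f(1) g(1)]] by simp
  qed
  moreover have "opword ws x - ?h x \<in> Z" if "x \<in> V" for x
  proof -
    have "opword ws x - ?h x = ?w1 (?w2 x - g x) - f (?w2 x - g x)"
      by (simp add: w endo_diff[OF e1] endo_diff[OF ef] algebra_simps)
    then show ?thesis using f(2) g(2) that by simp
  qed
  ultimately show "\<exists>f\<in>wspan S (Suc (l + m)). \<forall>x\<in>V. opword ws x - f x \<in> Z" by (intro bexI[where x = ?h] ballI)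
qed

end

context alg_closed_operator_space
begin

text \<open>V/W is modelled on a complement \<open>C\<close> of \<open>W\<close> in
  \<open>V\<close>, with projection \<open>\<pi>\<close>, each \<open>s\<close> becoming its
  compression \<open>\<pi> \<circ> s\<close>. This action is irreducible, and its word relations
  lift back modulo \<open>W\<close>.\<close>

lemma irreducible_quotient_length_bound:
  assumes S: "\<And>s. s \<in> S \<Longrightarrow> endo s"
    and V: "fin_subspace V" "\<forall>s\<in>S. \<forall>x\<in>V. s x \<in> V"
    and W: "subspace W" "W \<subset> V" "\<forall>s\<in>S. \<forall>x\<in>W. s x \<in> W"
    and irr: "\<And>Q. subspace Q \<Longrightarrow> W \<subseteq> Q \<Longrightarrow> Q \<subseteq> V \<Longrightarrow>
      \<forall>s\<in>S. \<forall>x\<in>Q. s x \<in> Q \<Longrightarrow> Q = W \<or> Q = V"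
    and m: "2 * real (dim V - dim W) * log 2 (real (dim V - dim W)) + 2 * real (dim V - dim W) - 2 < real m + 1"
  shows "length_bound S V W m"
proof -
  interpret vs_pair: vector_space_pair scale scale ..
  have sV: "subspace V" using V(1) fin_subspaceD by blast
  have fW: "fin_subspace W" using fin_subspace_subset[OF V(1) W(1)] W(2) by blast
  obtain D where D: "D \<subseteq> W" "independent D" "finite D" "span D = W" "card D = dim W"
    by (rule fin_subspace_basis[OF fW])
  have DV: "D \<subseteq> V" using D(1) W(2) by blast
  obtain E where E: "D \<subseteq> E" "E \<subseteq> V" "independent E" "finite E" "span E = V" "card E = dim V"
    by (rule fin_subspace_basis_extend[OF V(1) D(2) DV])
  obtain \<pi> where \<pi>: "endo \<pi>" "\<forall>x\<in>E. \<pi> x = (if x \<in> D then 0 else x)"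
    using vs_pair.linear_independent_extend[OF E(3), of "\<lambda>x. if x \<in> D then 0 else x"] by blast
  define C where "C = span (E - D)"
  have sC: "subspace C" by (simp add: C_def)
  have CV: "C \<subseteq> V" unfolding C_def E(5)[symmetric] by (rule span_mono) blast
  have fC: "fin_subspace C" using fin_subspace_subset[OF V(1) sC CV] .
  have dimC: "dim C = dim V - dim W"
    unfolding C_def using dim_span_eq_card_independent[OF independent_mono[OF E(3) Diff_subset]] E D
    by (simp add: card_Diff_subset)
  have \<pi>W: "\<pi> x = 0" if "x \<in> W" for x
  proof -
    have "W \<subseteq> {x. \<pi> x = 0}"
      unfolding D(4)[symmetric]
      by (rule span_minimal) (use \<pi> E(1) in \<open>auto simp: subspace_def endo_add endo_scale endo_zero\<close>)
    then show ?thesis using that by blast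
  qed
  have \<pi>C: "\<pi> x = x" if "x \<in> C" for x
  proof -
    have "C \<subseteq> {x. \<pi> x = x}"
      unfolding C_def
      by (rule span_minimal) (use \<pi> in \<open>auto simp: subspace_def endo_add endo_scale endo_zero\<close>)
    then show ?thesis using that by blast
  qed
  have \<pi>V: "\<pi> x \<in> C" "x - \<pi> x \<in> W" if "x \<in> V" for x
  proof -
    have "V \<subseteq> {x. \<pi> x \<in> C}" "V \<subseteq> {x. x - \<pi> x \<in> W}"
      unfolding E(5)[symmetric]
    proof (rule_tac [!] span_minimal)
      show "E \<subseteq> {x. \<pi> x \<in> C}"
        using \<pi>(2) subspace_0[OF sC] by (auto simp: C_def intro: span_base)
      show "E \<subseteq> {x. x - \<pi> x \<in> W}"
        using \<pi>(2) subspace_0[OF W(1)] D(1) by auto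
      show "subspace {x. \<pi> x \<in> C}"
        using subspace_preimage_on[OF \<pi>(1) subspace_UNIV sC] by simp
      have "endo (\<lambda>x. x - \<pi> x)" using \<pi>(1) by (simp add: endo_iff algebra_simps)
      then show "subspace {x. x - \<pi> x \<in> W}"
        using subspace_preimage_on[OF _ subspace_UNIV W(1)] by fastforce
    qed
    then show "\<pi> x \<in> C" "x - \<pi> x \<in> W" using that by auto
  qed
  define S' where "S' = (\<lambda>s. \<pi> \<circ> s) ` S"
  \<comment> \<open>Compression is multiplicative because \<open>s\<close> preserves
    \<open>W\<close>, the part that \<open>\<pi>\<close> discards.\<close>
  have \<pi>s: "\<pi> (s (\<pi> x)) = \<pi> (s x)" if "s \<in> S" "x \<in> V" for s x
  proof -
    have "\<pi> (s (x - \<pi> x)) = 0" using that W(3) \<pi>V \<pi>W by blast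
    then show ?thesis using that S by (simp add: endo_diff \<pi>(1))
  qed
  have "irreducible_ops_axioms scale S' C"
  proof (rule irreducible_ops_axioms.intro)
    show "endo s" if "s \<in> S'" for s using that S \<pi>(1) by (auto simp: S'_def intro: endo_comp)
    show "fin_subspace C" by (rule fC)
    have "0 < dim C"
      using fin_subspace_dim_less[OF V(1) W(1,2)] dimC by simp
    then show "C \<noteq> {0}" by auto
    show "s x \<in> C" if "s \<in> S'" "x \<in> C" for s x
      using that \<pi>V V(2) CV by (auto simp: S'_def)
    fix Q assume Q: "subspace Q" "Q \<subseteq> C" "\<And>s x. s \<in> S' \<Longrightarrow> x \<in> Q \<Longrightarrow> s x \<in> Q"
    \<comment> \<open>An invariant \<open>Q\<close> inside \<open>C\<close> corresponds to the
      invariant subspace Q + W between \<open>W\<close> and \<open>V\<close>.\<close>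
    let ?Y = "{x + w |x w. x \<in> Q \<and> w \<in> W}"
    have QY: "Q \<subseteq> ?Y"
    proof
      fix x assume "x \<in> Q"
      then show "x \<in> ?Y" using subspace_0[OF W(1)] by (intro CollectI exI[of _ x] exI[of _ 0]) simp
    qed
    have "?Y = W \<or> ?Y = V"
    proof (rule irr)
      show "subspace ?Y" using subspace_sums[OF Q(1) W(1)] .
      show "W \<subseteq> ?Y"
      proof
        fix w assume "w \<in> W"
        then show "w \<in> ?Y" using subspace_0[OF Q(1)] by (intro CollectI exI[of _ 0] exI[of _ w]) simp
      qed
      show "?Y \<subseteq> V" using Q(2) CV W(2) sV by (auto intro: subspace_add)
      show "\<forall>s\<in>S. \<forall>y\<in>?Y. s y \<in> ?Y"
      proof (intro ballI)
        fix s y assume s: "s \<in> S" and "y \<in> ?Y"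
        then obtain x w where xw: "y = x + w" "x \<in> Q" "w \<in> W" by blast
        have "s x \<in> V" using V(2) s xw(2) Q(2) CV by blast
        then have "s x - \<pi> (s x) \<in> W" using \<pi>V by blast
        then have "(s x - \<pi> (s x)) + s w \<in> W" using W(3) s xw(3) W(1) subspace_add by blast
        moreover have "\<pi> (s x) \<in> Q" using Q(3)[of "\<pi> \<circ> s" x] s xw(2) by (auto simp: S'_def)
        moreover have "s y = \<pi> (s x) + ((s x - \<pi> (s x)) + s w)"
          using xw(1) S[OF s] by (simp add: endo_add)
        ultimately show "s y \<in> ?Y" by blast
      qed
    qed
    then show "Q = {0} \<or> Q = C"
    proof
      assume "?Y = W"
      then have "Q \<subseteq> W" using QY by simp
      then have "x = 0" if "x \<in> Q" for x using that \<pi>W[of x] \<pi>C[of x] Q(2) by fastforce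
      then show ?thesis using subspace_0[OF Q(1)] by blast
    next
      assume Y: "?Y = V"
      have "c \<in> Q" if "c \<in> C" for c
      proof -
        have "c \<in> ?Y" unfolding Y using that CV by blast
        then obtain x w where xw: "c = x + w" "x \<in> Q" "w \<in> W" by blast
        then have "\<pi> c = x" using \<pi>W[of w] \<pi>C[of x] Q(2) by (auto simp: endo_add[OF \<pi>(1)])
        then show ?thesis using xw \<pi>C[OF that] by simp
      qed
      then show ?thesis using Q(2) by blast
    qed
  qed
  then interpret I: alg_closed_irreducible_ops scale S' C
    by (intro alg_closed_irreducible_ops.intro irreducible_ops.intro
        operator_space_axioms alg_closed_operator_space_axioms)
  have word: "\<exists>ws. set ws \<subseteq> S \<and> length ws = length vs \<and> (\<forall>x\<in>C. opword vs x = \<pi> (opword ws x))"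
    if "set vs \<subseteq> S'" for vs
    using that
  proof (induction vs)
    case Nil
    then show ?case using \<pi>C by auto
  next
    case (Cons v vs)
    then obtain ws where ws: "set ws \<subseteq> S" "length ws = length vs" "\<forall>x\<in>C. opword vs x = \<pi> (opword ws x)"
      by auto
    obtain s where s: "s \<in> S" "v = \<pi> \<circ> s" using Cons.prems by (auto simp: S'_def)
    have "opword ws x \<in> V" if "x \<in> C" for x
      using opword_invariant[OF ws(1) V(2)] that CV by blast
    then have "\<forall>x\<in>C. opword (v # vs) x = \<pi> (opword (s # ws) x)"
      using ws(3) s \<pi>s by simp
    then show ?case using ws s by (intro exI[of _ "s # ws"]) simp
  qed
  have lift: "\<exists>f\<in>wspan S k. \<forall>x\<in>C. f' x = \<pi> (f x)" if "f' \<in> wspan S' k" for f' k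
    using that
  proof (induction rule: wspan.induct)
    case (word vs)
    then show ?case using \<open>set vs \<subseteq> S' \<Longrightarrow> _\<close> wspan.word by metis
  next
    case (add f' g')
    then obtain f g where "f \<in> wspan S k" "\<forall>x\<in>C. f' x = \<pi> (f x)" "g \<in> wspan S k" "\<forall>x\<in>C. g' x = \<pi> (g x)"
      by blast
    then show ?case
      by (intro bexI[of _ "\<lambda>x. f x + g x"]) (auto simp: endo_add[OF \<pi>(1)] wspan.add)
  next
    case (scale f' c)
    then obtain f where "f \<in> wspan S k" "\<forall>x\<in>C. f' x = \<pi> (f x)" by blast
    then show ?case
      by (intro bexI[of _ "\<lambda>x. c *s f x"]) (auto simp: endo_scale[OF \<pi>(1)] wspan.scale)
  qed
  show ?thesis
    unfolding length_bound_def
  proof (intro allI impI)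
    fix ws assume ws: "set ws \<subseteq> S \<and> length ws = Suc m"
    let ?w = "opword ws"
    have ew: "endo ?w" using endo_opword ws S by blast
    have wV: "?w x \<in> V" if "x \<in> V" for x using opword_invariant[OF _ V(2) that] ws by blast
    have wW: "?w x \<in> W" if "x \<in> W" for x using opword_invariant[OF _ W(3) that] ws by blast
    obtain f' where f': "f' \<in> wspan S' m" "\<And>x. x \<in> C \<Longrightarrow> f' x = (\<pi> \<circ> ?w) x"
    proof (rule I.irreducible_length[of "\<pi> \<circ> ?w" m])
      show "endo (\<pi> \<circ> ?w)" using endo_comp[OF \<pi>(1) ew] .
      show "(\<pi> \<circ> ?w) x \<in> C" if "x \<in> C" for x using that CV wV \<pi>V by auto
    qed (use m dimC in auto)
    obtain f where f: "f \<in> wspan S m" "\<forall>x\<in>C. f' x = \<pi> (f x)" using lift[OF f'(1)] by blast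
    have ef: "endo f" using wspan_endo[OF f(1)] S by blast
    have fV: "f x \<in> V" if "x \<in> V" for x using wspan_invariant[OF f(1) sV V(2) that] by blast
    have fW: "f x \<in> W" if "x \<in> W" for x using wspan_invariant[OF f(1) W(1,3) that] by blast
    have "?w x - f x \<in> W" if x: "x \<in> V" for x
    proof -
      \<comment> \<open>On the component in \<open>C\<close>, \<open>\<pi>\<close> kills the
        difference of \<open>?w\<close> and \<open>f\<close>, which therefore lies in
        \<open>W\<close>; the component in \<open>W\<close> stays there by invariance.\<close>
      let ?y = "\<pi> x" and ?z = "x - \<pi> x"
      have y: "?y \<in> C" "?y \<in> V" and z: "?z \<in> W" using \<pi>V[OF x] CV by auto
      have "\<pi> (?w ?y - f ?y) = 0" using f(2) f'(2) y(1) by (simp add: endo_diff[OF \<pi>(1)])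
      moreover have "?w ?y - f ?y \<in> V" using wV fV y(2) sV by (simp add: subspace_diff)
      ultimately have "?w ?y - f ?y \<in> W" using \<pi>V(2) by fastforce
      moreover have "?w ?z - f ?z \<in> W" using wW fW z W(1) by (simp add: subspace_diff)
      moreover have "?w x - f x = (?w ?y - f ?y) + (?w ?z - f ?z)"
        by (simp add: endo_diff[OF ew] endo_diff[OF ef])
      ultimately show ?thesis using W(1) subspace_add by metis
    qed
    then show "\<exists>f\<in>wspan S m. \<forall>x\<in>V. ?w x - f x \<in> W" using f(1) by blast
  qed
qed

text \<open>A composition series in recursive form: an invariant subspace strictly in between splits
  the quotient, and superadditivity pays for the joining; otherwise the quotient is
  irreducible.\<close>

lemma quotient_length_bound:
  assumes S: "\<And>s. s \<in> S \<Longrightarrow> endo s"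
    and "fin_subspace V" "\<forall>s\<in>S. \<forall>x\<in>V. s x \<in> V"
    and "subspace W" "W \<subset> V" "\<forall>s\<in>S. \<forall>x\<in>W. s x \<in> W"
  shows "\<exists>m. length_bound S V W m \<and>
    real m \<le> 2 * real (dim V - dim W) * log 2 (real (dim V - dim W)) + 2 * real (dim V - dim W) - 2"
  using assms(2-)
proof (induction "dim V - dim W" arbitrary: V W rule: less_induct)
  case less
  let ?g = "\<lambda>n. 2 * real n * log 2 (real n) + 2 * real n - 2"
  have less_dim: "dim W < dim V" using fin_subspace_dim_less less.prems by blast
  show ?case
  proof (cases "\<exists>Q. subspace Q \<and> W \<subset> Q \<and> Q \<subset> V \<and> (\<forall>s\<in>S. \<forall>x\<in>Q. s x \<in> Q)")
    case True
    then obtain Q where Q: "subspace Q" "W \<subset> Q" "Q \<subset> V" "\<forall>s\<in>S. \<forall>x\<in>Q. s x \<in> Q" by blast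
    have fQ: "fin_subspace Q" using fin_subspace_subset less.prems(1) Q(1,3) by blast
    have d1: "dim W < dim Q" using fin_subspace_dim_less[OF fQ less.prems(3) Q(2)] .
    have d2: "dim Q < dim V" using fin_subspace_dim_less[OF less.prems(1) Q(1,3)] .
    have "dim V - dim Q < dim V - dim W" using d1 d2 by linarith
    from less.hyps[of V Q, OF this less.prems(1,2) Q(1,3,4)]
    obtain l where l: "length_bound S V Q l" "real l \<le> ?g (dim V - dim Q)" by blast
    have "dim Q - dim W < dim V - dim W" using d1 d2 by linarith
    from less.hyps[of Q W, OF this fQ Q(4) less.prems(3) Q(2) less.prems(5)]
    obtain m where m: "length_bound S Q W m" "real m \<le> ?g (dim Q - dim W)" by blast
    have "real (Suc (l + m)) \<le> ?g (dim V - dim Q) + ?g (dim Q - dim W) + 1"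
      using l(2) m(2) by (simp only: of_nat_Suc of_nat_add)
    also have "\<dots> \<le> ?g ((dim V - dim Q) + (dim Q - dim W))"
      using length_majorant_superadditive[of "real (dim V - dim Q)" "real (dim Q - dim W)"] d1 d2
      by (simp only: of_nat_add)
    also have "(dim V - dim Q) + (dim Q - dim W) = dim V - dim W" using d1 d2 by linarith
    finally show ?thesis using length_bound_trans[OF S l(1) m(1)] by blast
  next
    case False
    \<comment> \<open>The integer part of the bound, which is nonnegative because the quotient has
      dimension at least 1.\<close>
    define m where "m = nat \<lfloor>?g (dim V - dim W)\<rfloor>"
    have n1: "1 \<le> real (dim V - dim W)" using less_dim by linarith
    then have "0 \<le> 2 * real (dim V - dim W) * log 2 (real (dim V - dim W))" by simp
    then have "0 \<le> ?g (dim V - dim W)" using n1 by linarith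
    then have m: "real m \<le> ?g (dim V - dim W)" "?g (dim V - dim W) < real m + 1"
      unfolding m_def by linarith+
    have "length_bound S V W m"
      by (rule irreducible_quotient_length_bound[OF S less.prems _ m(2)]) (use False in blast)+
    then show ?thesis using m(1) by blast
  qed
qed

end

section \<open>Matrices\<close>

text \<open>As 1 is independent over the ground field, a linear functional on the closure can be
  prescribed to be 1 there. Applied entrywise, it carries linear relations back to the ground
  field.\<close>

lemma alg_closure_retraction:
  obtains \<phi> :: "'a::field alg_closure \<Rightarrow> 'a" where
    "\<And>x y. \<phi> (x + y) = \<phi> x + \<phi> y" "\<And>a x. \<phi> (to_ac a * x) = a * \<phi> x" "\<And>a. \<phi> (to_ac a) = a"
proof -
  let ?s = "\<lambda>a x. to_ac a * x :: 'a alg_closure"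
  interpret vector_space_pair ?s "(*) :: 'a \<Rightarrow> 'a \<Rightarrow> 'a"
    by unfold_locales (simp_all add: algebra_simps)
  have "vs1.independent {1}" by simp
  then obtain \<phi> where \<phi>: "Vector_Spaces.linear ?s (*) \<phi>" "\<forall>x\<in>{1}. \<phi> x = 1"
    using linear_independent_extend[of "{1}" "\<lambda>_. 1"] by blast
  have add: "\<phi> (x + y) = \<phi> x + \<phi> y" and scale: "\<phi> (to_ac a * x) = a * \<phi> x" for x y a
    using \<phi>(1) by (simp_all add: Vector_Spaces.linear_iff)
  moreover have "\<phi> (to_ac a) = a" for a using scale[of a 1] \<phi>(2) by simp
  ultimately show thesis using that by blast
qed

text \<open>The dimension \<open>n\<close> is a value and not a type, so vectors are sequences, and
  \<open>coord_space n\<close> cuts out those supported below \<open>n\<close>.\<close>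

definition fun_scale :: "'k::field \<Rightarrow> (nat \<Rightarrow> 'k) \<Rightarrow> nat \<Rightarrow> 'k" where
  "fun_scale c x = (\<lambda>i. c * x i)"

interpretation fun_space: alg_closed_operator_space "fun_scale :: 'k::alg_closed_field \<Rightarrow> _"
  by unfold_locales (auto simp: fun_scale_def fun_eq_iff algebra_simps)

text \<open>The output is cut off at \<open>n\<close>, so the identity matrix acts as the identity
  only on \<open>coord_space n\<close>. Hence the restriction to this space in
  \<open>mat_op_one\<close> and \<open>opword_mat_op\<close>.\<close>

definition mat_op :: "nat \<Rightarrow> 'a::field mat \<Rightarrow> (nat \<Rightarrow> 'a alg_closure) \<Rightarrow> nat \<Rightarrow> 'a alg_closure" where
  "mat_op n A x = (\<lambda>i. if i < n then \<Sum>j<n. to_ac (A $$ (i, j)) * x j else 0)"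

definition coord_space :: "nat \<Rightarrow> (nat \<Rightarrow> 'k::zero) set" where
  "coord_space n = {x. \<forall>i\<ge>n. x i = 0}"

definition unit_fun :: "nat \<Rightarrow> nat \<Rightarrow> 'k::zero_neq_one" where
  "unit_fun j = (\<lambda>i. if i = j then 1 else 0)"

lemma endo_mat_op: "fun_space.endo (mat_op n A)"
  by (auto simp: fun_space.endo_iff mat_op_def fun_scale_def fun_eq_iff sum.distrib
      sum_distrib_left algebra_simps)

lemma mat_op_closed: "mat_op n A x \<in> coord_space n"
  by (simp add: mat_op_def coord_space_def)

lemma mat_op_one: "x \<in> coord_space n \<Longrightarrow> mat_op n (1\<^sub>m n) x = x"
  by (auto simp: mat_op_def coord_space_def fun_eq_iff if_distrib[of to_ac] if_distrib[of "\<lambda>c. c * _"] cong: if_cong)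

lemma mat_op_mult:
  assumes "A \<in> carrier_mat n n" "B \<in> carrier_mat n n"
  shows "mat_op n (A * B) x = mat_op n A (mat_op n B x)"
proof
  fix i
  show "mat_op n (A * B) x i = mat_op n A (mat_op n B x) i"
  proof (cases "i < n")
    case True
    have "mat_op n (A * B) x i = (\<Sum>j<n. \<Sum>k<n. to_ac (A $$ (i, k)) * to_ac (B $$ (k, j)) * x j)"
      using assms True
      by (simp add: mat_op_def scalar_prod_def to_ac_sum sum_distrib_right atLeast0LessThan)
    also have "\<dots> = (\<Sum>k<n. \<Sum>j<n. to_ac (A $$ (i, k)) * to_ac (B $$ (k, j)) * x j)"
      by (rule sum.swap)
    also have "\<dots> = mat_op n A (mat_op n B x) i"
      using True by (simp add: mat_op_def sum_distrib_left mult.assoc)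
    finally show ?thesis .
  qed (simp add: mat_op_def)
qed

lemma mat_op_unit_fun: "i < n \<Longrightarrow> j < n \<Longrightarrow> mat_op n A (unit_fun j) i = to_ac (A $$ (i, j))"
  by (simp add: mat_op_def unit_fun_def if_distrib[of "\<lambda>c. _ * c"] cong: if_cong)

lemma unit_fun_in_coord_space: "j < n \<Longrightarrow> unit_fun j \<in> coord_space n"
  by (simp add: unit_fun_def coord_space_def)

lemma word_carrier: "set As \<subseteq> carrier_mat n n \<Longrightarrow> foldr (*) As (1\<^sub>m n) \<in> carrier_mat n n"
  by (induction As) auto

lemma opword_mat_op:
  "set As \<subseteq> carrier_mat n n \<Longrightarrow> x \<in> coord_space n \<Longrightarrow>
    fun_space.opword (map (mat_op n) As) x = mat_op n (foldr (*) As (1\<^sub>m n)) x"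
  by (induction As) (auto simp: mat_op_one mat_op_mult word_carrier)

lemma coord_space_fin:
  "fun_space.fin_subspace (coord_space n :: (nat \<Rightarrow> 'k::alg_closed_field) set)"
  "fun_space.dim (coord_space n :: (nat \<Rightarrow> 'k::alg_closed_field) set) \<le> n"
proof -
  let ?V = "coord_space n :: (nat \<Rightarrow> 'k) set" and ?B = "unit_fun ` {..<n} :: (nat \<Rightarrow> 'k) set"
  have "x \<in> fun_space.span ?B" if "x \<in> ?V" for x
  proof -
    have "(\<Sum>j<n. fun_scale (x j) (unit_fun j)) i = x i" for i
    proof -
      have "(\<Sum>j<n. fun_scale (x j) (unit_fun j)) i = (\<Sum>j<n. fun_scale (x j) (unit_fun j) i)"
        by (induction n) (auto simp: plus_fun_def)
      also have "\<dots> = x i"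
        using that by (auto simp: fun_scale_def unit_fun_def coord_space_def if_distrib[of "\<lambda>c. _ * c"] cong: if_cong)
      finally show ?thesis .
    qed
    then have "x = (\<Sum>j<n. fun_scale (x j) (unit_fun j))" by auto
    then show ?thesis
      by (metis (no_types, lifting) fun_space.span_sum fun_space.span_scale fun_space.span_base imageI)
  qed
  then have sub: "?V \<subseteq> fun_space.span ?B" by blast
  moreover have "fun_space.subspace ?V"
    by (auto simp: fun_space.subspace_def coord_space_def fun_scale_def)
  ultimately show "fun_space.fin_subspace ?V"
    unfolding fun_space.fin_subspace_def by blast
  have "fun_space.dim ?V \<le> card ?B" using fun_space.dim_le_card[OF sub] by simp
  also have "\<dots> \<le> n" using card_image_le[of "{..<n}" unit_fun] by simp
  finally show "fun_space.dim ?V \<le> n" .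
qed

lemma words_upto_carrier: "S \<subseteq> carrier_mat n n \<Longrightarrow> words_upto n S k \<subseteq> carrier_mat n n"
  using word_carrier by (fastforce simp: words_upto_def)

section \<open>Spans of matrix words and descent to the ground field\<close>

context
  fixes n :: nat and S :: "'a::field mat set"
  assumes S: "S \<subseteq> carrier_mat n n"
begin

interpretation mat: matrix_vs n n "TYPE('a)" .

lemma span_upto_submodule: "submodule class_ring (span_upto n S k) (module_mat TYPE('a) n n)"
  unfolding span_upto_def
  by (rule mat.span_is_submodule) (use words_upto_carrier[OF S] in \<open>simp add: module_mat_simps\<close>)

lemma span_upto_carrier: "M \<in> span_upto n S k \<Longrightarrow> M \<in> carrier_mat n n"
  using submodule.subset[OF span_upto_submodule] by (auto simp: module_mat_simps)

lemma span_upto_add: "M \<in> span_upto n S k \<Longrightarrow> N \<in> span_upto n S k \<Longrightarrow> M + N \<in> span_upto n S k"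
  using submodule.m_closed[OF span_upto_submodule] by (simp add: module_mat_simps)

lemma span_upto_smult: "M \<in> span_upto n S k \<Longrightarrow> c \<cdot>\<^sub>m M \<in> span_upto n S k"
  using submodule.smult_closed[OF span_upto_submodule, of c] by (simp add: module_mat_simps class_ring_simps)

lemma span_upto_base: "M \<in> words_upto n S k \<Longrightarrow> M \<in> span_upto n S k"
  using mat.in_own_span[of "words_upto n S k"] words_upto_carrier[OF S]
  by (auto simp: span_upto_def module_mat_simps)

lemma span_upto_minimal:
  assumes "words_upto n S k \<subseteq> B" "submodule class_ring B (module_mat TYPE('a) n n)"
  shows "span_upto n S k \<subseteq> B"
  unfolding span_upto_def by (rule mat.span_is_subset[OF assms])

lemma span_upto_zero: "0\<^sub>m n n \<in> span_upto n S k"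
  using submodule.zero_closed[OF span_upto_submodule] by (simp add: module_mat_simps)

lemma span_upto_induct [consumes 1, case_names word zero add smult]:
  assumes "M \<in> span_upto n S k"
    and "\<And>As. set As \<subseteq> S \<Longrightarrow> length As \<le> k \<Longrightarrow> P (foldr (*) As (1\<^sub>m n))"
    and "P (0\<^sub>m n n)"
    and "\<And>M N. M \<in> carrier_mat n n \<Longrightarrow> N \<in> carrier_mat n n \<Longrightarrow> P M \<Longrightarrow> P N \<Longrightarrow> P (M + N)"
    and "\<And>c M. M \<in> carrier_mat n n \<Longrightarrow> P M \<Longrightarrow> P (c \<cdot>\<^sub>m M)"
  shows "P M"
proof -
  have "submodule class_ring {M \<in> carrier_mat n n. P M} (module_mat TYPE('a) n n)"
    by (rule submodule.intro[OF mat.module_axioms])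
      (use assms(3-5) in \<open>auto simp: module_mat_simps class_ring_simps\<close>)
  moreover have "words_upto n S k \<subseteq> {M \<in> carrier_mat n n. P M}"
    using assms(2) words_upto_carrier[OF S, of k] by (auto simp: words_upto_def)
  ultimately show ?thesis using span_upto_minimal assms(1) by blast
qed

text \<open>The factor \<open>c\<close> makes the statement stable under scaling by elements of the closure.\<close>

lemma wspan_descent:
  assumes \<phi>: "\<And>x y. \<phi> (x + y) = \<phi> x + \<phi> y" "\<And>a x. \<phi> (to_ac a * x) = a * \<phi> x"
    and f: "f \<in> fun_space.wspan (mat_op n ` S) k"
  shows "\<exists>M\<in>span_upto n S k. \<forall>i<n. \<forall>j<n. \<phi> (c * f (unit_fun j) i) = M $$ (i, j)"
  using f
proof (induction arbitrary: c rule: fun_space.wspan.induct)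
  case (word ws)
  have "ws \<in> map (mat_op n) ` lists S"
    using word(1) unfolding lists_image[symmetric] by (auto simp: lists_eq_set)
  then obtain As where As: "set As \<subseteq> S" "ws = map (mat_op n) As" by (auto simp: lists_eq_set)
  let ?M = "foldr (*) As (1\<^sub>m n)"
  have AsC: "set As \<subseteq> carrier_mat n n" using As S by blast
  have M: "?M \<in> carrier_mat n n" using word_carrier[OF AsC] .
  have "?M \<in> words_upto n S k" using As word(2) by (auto simp: words_upto_def)
  \<comment> \<open>The entries of a word come from the ground field, so \<open>\<phi>\<close> pulls
    them out and leaves the coefficient \<open>\<phi> c\<close>.\<close>
  then have "\<phi> c \<cdot>\<^sub>m ?M \<in> span_upto n S k" using span_upto_smult span_upto_base by blast
  moreover have "\<phi> (c * fun_space.opword ws (unit_fun j) i) = (\<phi> c \<cdot>\<^sub>m ?M) $$ (i, j)"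
    if "i < n" "j < n" for i j
    using that M \<phi>(2)[of "?M $$ (i, j)" c] As(2) opword_mat_op[OF AsC unit_fun_in_coord_space]
    by (simp add: mat_op_unit_fun mult.commute)
  ultimately show ?case by blast
next
  case (add f g)
  obtain M where M: "M \<in> span_upto n S k" "\<forall>i<n. \<forall>j<n. \<phi> (c * f (unit_fun j) i) = M $$ (i, j)"
    using add.IH(1) by blast
  obtain N where N: "N \<in> span_upto n S k" "\<forall>i<n. \<forall>j<n. \<phi> (c * g (unit_fun j) i) = N $$ (i, j)"
    using add.IH(2) by blast
  have "\<forall>i<n. \<forall>j<n. \<phi> (c * (f (unit_fun j) + g (unit_fun j)) i) = (M + N) $$ (i, j)"
    using M N span_upto_carrier[OF M(1)] span_upto_carrier[OF N(1)]
    by (simp add: plus_fun_def distrib_left \<phi>(1))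
  then show ?case using span_upto_add[OF M(1) N(1)] by blast
next
  case (scale f d)
  then show ?case using scale.IH[of "c * d"] by (simp add: fun_scale_def mult.assoc)
qed

text \<open>Over the closure the word equals a combination \<open>f\<close> of shorter ones.
  Evaluating at the unit vectors and applying \<open>\<phi>\<close> fixes the entries of the word
  and turns those of \<open>f\<close> into a matrix of the span over the ground field.\<close>

lemma word_in_span_upto:
  assumes bound: "fun_space.length_bound (mat_op n ` S) (coord_space n) {0} m"
    and As: "set As \<subseteq> S" "length As = Suc m"
  shows "foldr (*) As (1\<^sub>m n) \<in> span_upto n S m"
proof -
  obtain \<phi> :: "'a alg_closure \<Rightarrow> 'a" where
    \<phi>: "\<And>x y. \<phi> (x + y) = \<phi> x + \<phi> y" "\<And>a x. \<phi> (to_ac a * x) = a * \<phi> x" "\<And>a. \<phi> (to_ac a) = a"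
    by (rule alg_closure_retraction) blast
  let ?w = "fun_space.opword (map (mat_op n) As)"
  have AsC: "set As \<subseteq> carrier_mat n n" using As S by blast
  have W: "foldr (*) As (1\<^sub>m n) \<in> carrier_mat n n" using word_carrier[OF AsC] .
  have "set (map (mat_op n) As) \<subseteq> mat_op n ` S" using As(1) by auto
  then obtain f where f: "f \<in> fun_space.wspan (mat_op n ` S) m" "\<forall>x\<in>coord_space n. ?w x - f x \<in> {0}"
    using bound As(2) unfolding fun_space.length_bound_def by (metis length_map)
  obtain M where M: "M \<in> span_upto n S m" "\<forall>i<n. \<forall>j<n. \<phi> (1 * f (unit_fun j) i) = M $$ (i, j)"
    using wspan_descent[OF \<phi>(1,2) f(1)] by blast
  have "foldr (*) As (1\<^sub>m n) = M"
  proof (rule eq_matI)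
    fix i j assume "i < dim_row M" "j < dim_col M"
    then have ij: "i < n" "j < n" using span_upto_carrier[OF M(1)] by auto
    have "f (unit_fun j) = mat_op n (foldr (*) As (1\<^sub>m n)) (unit_fun j)"
      using f(2) unit_fun_in_coord_space[OF ij(2)] opword_mat_op[OF AsC] by force
    then have "f (unit_fun j) i = to_ac (foldr (*) As (1\<^sub>m n) $$ (i, j))"
      using mat_op_unit_fun[OF ij] by simp
    moreover have "\<phi> (1 * f (unit_fun j) i) = M $$ (i, j)" using M(2) ij by blast
    ultimately show "foldr (*) As (1\<^sub>m n) $$ (i, j) = M $$ (i, j)" using \<phi>(3) by simp
  qed (use W span_upto_carrier[OF M(1)] in auto)
  then show ?thesis using M(1) by simp
qed

text \<open>When words of m + 1 letters reduce, the span is closed under left multiplication by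
  letters, hence by words, hence by itself, and is a unital subalgebra. Conversely every unital
  subalgebra containing \<open>S\<close> contains all words.\<close>

lemma span_upto_eq_generated:
  assumes words: "\<And>As. set As \<subseteq> S \<Longrightarrow> length As = Suc m \<Longrightarrow> foldr (*) As (1\<^sub>m n) \<in> span_upto n S m"
  shows "span_upto n S m = generated_algebra n S"
proof
  have word: "foldr (*) As (1\<^sub>m n) \<in> span_upto n S m" if "set As \<subseteq> S" "length As \<le> Suc m" for As
  proof (cases "length As = Suc m")
    case True
    then show ?thesis using words that by blast
  next
    case False
    then show ?thesis using that by (intro span_upto_base) (auto simp: words_upto_def)
  qed
  have left_letter: "A * M \<in> span_upto n S m" if "M \<in> span_upto n S m" "A \<in> S" for A M
  proof -
    have A: "A \<in> carrier_mat n n" using that S by blast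
    show ?thesis using that(1)
    proof (induction rule: span_upto_induct)
      case (word As)
      then show ?case using \<open>\<And>As. set As \<subseteq> S \<Longrightarrow> length As \<le> Suc m \<Longrightarrow> _\<close>[of "A # As"] that(2) by simp
    next
      case zero
      then show ?case using A span_upto_zero by simp
    next
      case (add M N)
      then show ?case using A by (simp add: mult_add_distrib_mat span_upto_add)
    next
      case (smult c M)
      then show ?case using A by (simp add: mult_smult_distrib span_upto_smult)
    qed
  qed
  have left_word: "foldr (*) As (1\<^sub>m n) * M \<in> span_upto n S m" if "set As \<subseteq> S" "M \<in> span_upto n S m" for As M
    using that(1)
  proof (induction As)
    case Nil
    then show ?case using that(2) left_mult_one_mat[OF span_upto_carrier[OF that(2)]] by simp
  next
    case (Cons A As)
    moreover have "A \<in> carrier_mat n n" "foldr (*) As (1\<^sub>m n) \<in> carrier_mat n n" "M \<in> carrier_mat n n"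
      using Cons.prems S word_carrier[of As n] span_upto_carrier[OF that(2)] by auto
    ultimately show ?case using left_letter by simp
  qed
  have mult: "N * M \<in> span_upto n S m" if "N \<in> span_upto n S m" "M \<in> span_upto n S m" for M N
  proof -
    have M: "M \<in> carrier_mat n n" using span_upto_carrier that(2) .
    show ?thesis using that(1)
    proof (induction rule: span_upto_induct)
      case (word As)
      then show ?case using left_word that(2) by blast
    next
      case zero
      then show ?case using M span_upto_zero by simp
    next
      case (add N N')
      then show ?case using M by (simp add: add_mult_distrib_mat[where nr = n and nc = n] span_upto_add)
    next
      case (smult c N)
      then show ?case using M by (simp add: mult_smult_assoc_mat[where nr = n and n = n] span_upto_smult)
    qed
  qed
  interpret R: ring "ring_mat TYPE('a) n ()" by (rule ring_mat)
  have "subring (span_upto n S m) (ring_mat TYPE('a) n ())"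
  proof (rule R.subringI)
    show "span_upto n S m \<subseteq> carrier (ring_mat TYPE('a) n ())"
      using span_upto_carrier by (auto simp: ring_mat_simps)
    show "\<one>\<^bsub>ring_mat TYPE('a) n ()\<^esub> \<in> span_upto n S m"
      using word[of "[]"] by (simp add: ring_mat_simps)
    show "\<ominus>\<^bsub>ring_mat TYPE('a) n ()\<^esub> M \<in> span_upto n S m" if M: "M \<in> span_upto n S m" for M
    proof -
      have "M \<in> carrier_mat n n" using span_upto_carrier[OF M] .
      then have "\<ominus>\<^bsub>ring_mat TYPE('a) n ()\<^esub> M = (-1) \<cdot>\<^sub>m M"
        by (intro R.minus_equality) (auto simp: ring_mat_simps)
      then show ?thesis using span_upto_smult[OF M] by simp
    qed
  qed (auto simp: ring_mat_simps mult span_upto_add)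
  then have "unital_subalgebra n (span_upto n S m)"
    using span_upto_smult by (simp add: unital_subalgebra_def)
  moreover have "S \<subseteq> span_upto n S m"
  proof
    fix A assume "A \<in> S"
    then show "A \<in> span_upto n S m" using word[of "[A]"] S by auto
  qed
  ultimately show "generated_algebra n S \<subseteq> span_upto n S m"
    by (auto simp: generated_algebra_def)
  have "span_upto n S m \<subseteq> B" if B: "unital_subalgebra n B" "S \<subseteq> B" for B
  proof
    have sub: "subring B (ring_mat TYPE('a) n ())" and smult: "\<And>c A. A \<in> B \<Longrightarrow> c \<cdot>\<^sub>m A \<in> B"
      using B by (auto simp: unital_subalgebra_def)
    note B' = subringE[OF sub, unfolded ring_mat_simps]
    fix M assume "M \<in> span_upto n S m"
    then show "M \<in> B"
    proof (induction rule: span_upto_induct)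
      case (word As)
      from word(1) show ?case by (induction As) (use B' B(2) in auto)
    qed (use B' smult in auto)
  qed
  then show "span_upto n S m \<subseteq> generated_algebra n S"
    by (auto simp: generated_algebra_def)
qed

end

theorem theorem3:
  fixes n :: nat and S :: "'a::field mat set"
  assumes "n \<ge> 1" and "S \<subseteq> carrier_mat n n"
  shows "real (alg_length n S) \<le> 2 * real n * log 2 (real n) + 4 * real n - 4"
proof -
  let ?V = "coord_space n :: (nat \<Rightarrow> 'a alg_closure) set"
  let ?d = "fun_space.dim ?V - fun_space.dim ({0} :: (nat \<Rightarrow> 'a alg_closure) set)"
  \<comment> \<open>As n \<ge> 1, the coordinate space is nonzero and \<open>{0}\<close> is a proper
    subspace.\<close>
  have "unit_fun 0 \<in> ?V" "unit_fun 0 \<noteq> (0 :: nat \<Rightarrow> 'a alg_closure)"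
    using assms(1) unit_fun_in_coord_space[of 0 n] by (auto simp: unit_fun_def fun_eq_iff)
  moreover have "0 \<in> ?V" by (simp add: coord_space_def)
  ultimately have "{0} \<subset> ?V" by blast
  then have "\<exists>m. fun_space.length_bound (mat_op n ` S) ?V {0} m \<and>
      real m \<le> 2 * real ?d * log 2 (real ?d) + 2 * real ?d - 2"
    by (intro fun_space.quotient_length_bound)
      (auto simp: coord_space_fin(1) endo_mat_op mat_op_closed fun_space.endo_zero[OF endo_mat_op])
  then obtain m where m: "fun_space.length_bound (mat_op n ` S) ?V {0} m"
    "real m \<le> 2 * real ?d * log 2 (real ?d) + 2 * real ?d - 2" by blast
  have "span_upto n S m = generated_algebra n S"
    using span_upto_eq_generated[OF assms(2)] word_in_span_upto[OF assms(2) m(1)] by blast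
  then have "real (alg_length n S) \<le> real m"
    unfolding alg_length_def by (simp add: Least_le)
  also note m(2)
  also have "2 * real ?d * log 2 (real ?d) + 2 * real ?d - 2 \<le> 2 * real n * log 2 (real n) + 2 * real n - 2"
  proof -
    have d: "?d \<le> n" using coord_space_fin(2)[where 'k = "'a alg_closure", of n] by simp
    have "real ?d * log 2 (real ?d) \<le> real n * log 2 (real n)"
    \<comment> \<open>The logarithm is monotone only on positive arguments; in dimension 0 the left
      side vanishes through its factor \<open>real ?d\<close>.\<close>
    proof (cases "?d = 0")
      case True
      then show ?thesis using assms(1) by simp
    next
      case False
      then show ?thesis using d by (intro mult_mono) auto
    qed
    then show ?thesis using d by (simp add: mult.assoc)
  qed
  \<comment> \<open>The bound reached so far is sharper: 2 n - 2 \<le> 4 n - 4 as n \<ge> 1.\<close>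
  also have "\<dots> \<le> 2 * real n * log 2 (real n) + 4 * real n - 4" using assms(1) by simp
  finally show ?thesis .
qed

end
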